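(* Let $v>-1$ and $q\in Q_v$. If $\phi$ is of $q$-positive type, then there exists a positive (i.e. $\xi\ge 0$) function $\xi\in\mathcal{A}_{q,v}$ such that $$\phi(x)=\mathcal{F}_{q,v}\xi(x),\quad\forall x\in\mathbb{R}_q^+.$$
   Context: Fix $0<q<1$ and $v>-1$. $\mathbb{R}_q^+=\{q^n : n\in\mathbb{Z}\}$; $(a;q)_0=1$, $(a;q)_n=\prod_{i=0}^{n-1}(1-aq^i)$, $n=1,\ldots,\infty$. Functions are complex valued. Jackson's integral is $\int_0^\infty f(x)\,d_qx=(1-q)\sum_{n\in\mathbb{Z}}q^nf(q^n)$. $\mathcal{L}_{q,1,v}$ is the space of functions $f$ on $\mathbb{R}_q^+$ with $\int_0^\infty |f(x)|x^{2v+1}d_qx<\infty$. $\mathcal{C}_{q,b}$ is the space of bounded functions on $\mathbb{R}_q^+$ that are continuous at $0$ (i.e. $\lim_{n\to\infty}f(q^n)$ exists). The normalized Hahn-Exton $q$-Bessel function is $$j_v(z,q^2)=\sum_{n=0}^\infty(-1)^n\frac{q^{n(n+1)}}{(q^2;q^2)_n(q^{2v+2};q^2)_n}z^{2n}.$$ Put $c_{q,v}=\frac{1}{1-q}\frac{(q^{2v+2};q^2)_\infty}{(q^2;q^2)_\infty}$. The $q$-Bessel Fourier transform of $f\in\mathcal{L}_{q,1,v}$ is $\mathcal{F}_{q,v}f(x)=c_{q,v}\int_0^\infty f(t)j_v(xt,q^2)t^{2v+1}d_qt$. The $q$-Wiener algebra is $\mathcal{A}_{q,v}=\{f\in\mathcal{L}_{q,1,v}:\mathcal{F}_{q,v}f\in\mathcal{L}_{q,1,v}\}$.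 The $q$-Bessel translation is, for $f\in\mathcal{L}_{q,1,v}$ and $x,y\in\mathbb{R}_q^+$, $$T^v_{q,x}f(y)=c_{q,v}\int_0^\infty\mathcal{F}_{q,v}f(t)\,j_v(xt,q^2)j_v(yt,q^2)t^{2v+1}d_qt.$$ $T^v_{q,x}$ is called positive if $T^v_{q,x}f\ge 0$ whenever $f\geq 0$, and $Q_v=\{q\in]0,1[\,:\,T^v_{q,x}\text{ is positive for all }x\in\mathbb{R}_q^+\}$. A function $\phi$ is of $q$-positive type if $\phi\in\mathcal{C}_{q,b}\cap\mathcal{L}_{q,1,v}$ and for any finite list of complex numbers $z_1,\ldots,z_n$ and elements $x_1,\ldots,x_n\in\mathbb{R}_q^+$, $\sum_{r=1}^n\sum_{l=1}^n z_r\overline{z_l}\,T^v_{q,x_r}\phi(x_l)\geq 0$. *)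

theory Defs
  imports "HOL-Analysis.Analysis"
begin

text \<open>
  Functions on \<open>Rq q\<close> are represented by functions of type \<^typ>\<open>real \<Rightarrow> complex\<close>; every
  notion below depends only on their values on \<open>Rq q\<close>. That a complex number \<open>z\<close>
  satisfies \<open>z \<ge> 0\<close> (it is real and nonnegative) is written \<open>z \<in> \<real>\<^sub>\<ge>\<^sub>0\<close>.
\<close>

definition Rq :: "real \<Rightarrow> real set" where
  "Rq q = range (\<lambda>n::int. q powi n)"

definition qpoch :: "real \<Rightarrow> real \<Rightarrow> nat \<Rightarrow> real" where
  "qpoch a q n = (\<Prod>i<n. 1 - a * q ^ i)"

definition qpoch_inf :: "real \<Rightarrow> real \<Rightarrow> real" where
  "qpoch_inf a q = (\<Prod>i. 1 - a * q ^ i)"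

definition jackson_integrable :: "real \<Rightarrow> (real \<Rightarrow> 'a::real_normed_vector) \<Rightarrow> bool" where
  "jackson_integrable q f \<longleftrightarrow> (\<lambda>n::int. q powi n *\<^sub>R f (q powi n)) summable_on UNIV"

definition jackson_integral :: "real \<Rightarrow> (real \<Rightarrow> 'a::real_normed_vector) \<Rightarrow> 'a" where
  "jackson_integral q f = (1 - q) *\<^sub>R (\<Sum>\<^sub>\<infinity>n::int. q powi n *\<^sub>R f (q powi n))"

definition L1q :: "real \<Rightarrow> real \<Rightarrow> (real \<Rightarrow> complex) set" where
  "L1q q v = {f. jackson_integrable q (\<lambda>x. cmod (f x) * x powr (2 * v + 1))}"

definition Cqb :: "real \<Rightarrow> (real \<Rightarrow> complex) set" where
  "Cqb q = {f. bounded (f ` Rq q) \<and> convergent (\<lambda>n::nat. f (q ^ n))}"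

text \<open>\<open>qbessel q v z\<close> is $j_v(z,q^2)$: the parameter is \<open>q\<close>, while the base of the series is \<open>q^2\<close>.\<close>

definition qbessel :: "real \<Rightarrow> real \<Rightarrow> 'a::{real_normed_field,banach} \<Rightarrow> 'a" where
  "qbessel q v z = (\<Sum>n. of_real ((-1) ^ n * q ^ (n * (n + 1)) /
      (qpoch (q\<^sup>2) (q\<^sup>2) n * qpoch (q powr (2 * v + 2)) (q\<^sup>2) n)) * z ^ (2 * n))"

definition cqv :: "real \<Rightarrow> real \<Rightarrow> real" where
  "cqv q v = 1 / (1 - q) * (qpoch_inf (q powr (2 * v + 2)) (q\<^sup>2) / qpoch_inf (q\<^sup>2) (q\<^sup>2))"

definition qfourier :: "real \<Rightarrow> real \<Rightarrow> (real \<Rightarrow> complex) \<Rightarrow> real \<Rightarrow> complex" where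
  "qfourier q v f x = of_real (cqv q v) *
     jackson_integral q (\<lambda>t. f t * of_real (qbessel q v (x * t)) * of_real (t powr (2 * v + 1)))"

definition qwiener :: "real \<Rightarrow> real \<Rightarrow> (real \<Rightarrow> complex) set" where
  "qwiener q v = {f \<in> L1q q v. qfourier q v f \<in> L1q q v}"

definition qtrans :: "real \<Rightarrow> real \<Rightarrow> real \<Rightarrow> (real \<Rightarrow> complex) \<Rightarrow> real \<Rightarrow> complex" where
  "qtrans q v x f y = of_real (cqv q v) *
     jackson_integral q (\<lambda>t. qfourier q v f t * of_real (qbessel q v (x * t)) *
       of_real (qbessel q v (y * t)) * of_real (t powr (2 * v + 1)))"

definition qtrans_positive :: "real \<Rightarrow> real \<Rightarrow> real \<Rightarrow> bool" where
  "qtrans_positive q v x \<longleftrightarrow>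
     (\<forall>f \<in> L1q q v. (\<forall>y \<in> Rq q. f y \<in> \<real>\<^sub>\<ge>\<^sub>0) \<longrightarrow> (\<forall>y \<in> Rq q. qtrans q v x f y \<in> \<real>\<^sub>\<ge>\<^sub>0))"

definition Qv :: "real \<Rightarrow> real set" where
  "Qv v = {q \<in> {0<..<1}. \<forall>x \<in> Rq q. qtrans_positive q v x}"

definition q_positive_type :: "real \<Rightarrow> real \<Rightarrow> (real \<Rightarrow> complex) \<Rightarrow> bool" where
  "q_positive_type q v \<phi> \<longleftrightarrow> \<phi> \<in> Cqb q \<inter> L1q q v \<and>
     (\<forall>(n::nat) (z :: nat \<Rightarrow> complex) (x :: nat \<Rightarrow> real). (\<forall>r \<in> {1..n}. x r \<in> Rq q) \<longrightarrow>
        (\<Sum>r=1..n. \<Sum>l=1..n. z r * cnj (z l) * qtrans q v (x r) \<phi> (x l)) \<in> \<real>\<^sub>\<ge>\<^sub>0)"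

end

theory Submission
  imports Defs
begin

text \<open>
  The natural candidate is \<open>\<xi> = qfourier q v \<phi>\<close>. Three things have to be shown: the inversion formula,
  \<open>\<xi> \<ge> 0\<close>, and integrability of \<open>\<xi>\<close>. All three rest on one explicit function, the q-analogue
  $K(x) = (q^2x^2;q^2)_\infty$ (up to a constant) of a Gaussian. On the lattice it is nonnegative and supported in
  \<open>x \<le> 1\<close>, and it is its own Bessel transform (\<open>bessel_fourier_K\<close>): summing the Bessel series term by
  term against \<open>K\<close> uses Euler's first q-exponential identity for the moments of \<open>K\<close> and the second one to
  resum the result.

  The unit mass at a lattice point is a rapidly converging combination of dilates of \<open>K\<close>, because the
  two Euler series are inverse to each other. Transforming this combination expands the Bessel function in dilates of \<open>K\<close>
  (\<open>J_expansion\<close>), which shows that it is bounded and integrable on the lattice; transforming it twice gives the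
  orthogonality relation (\<open>J_orthogonal\<close>). Fubini and orthogonality give the inversion formula
  \<open>bessel_fourier_inversion\<close> for integrable functions.

  For positivity (\<open>nonneg_of_positive_definite\<close>), the quadratic form in the definition of positive type is the integral of \<open>\<xi>\<close> against
  $|\sum_r z_r j_v(x_r t)|^2$. By orthogonality, the \<open>z\<close> can be chosen so that these squares concentrate at any given
  lattice point, and the value of \<open>\<xi>\<close> there is, up to a positive factor, a limit of nonnegative numbers.

  For integrability (\<open>bessel_fourier_nonneg_summable\<close>), the integral of \<open>\<xi>\<close> against a dilate of \<open>K\<close> equals the
  integral of \<open>\<phi>\<close> against the transform of that dilate, which is a normalised dilate of \<open>K\<close>. So it is bounded by the supremum of
  \<open>|\<phi>|\<close> times a constant that does not depend on the dilation. Letting the dilates increase to a positive constant, the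
  nonnegativity of \<open>\<xi>\<close> bounds its integral. Since \<open>\<phi>\<close> is integrable and is the transform of \<open>\<xi>\<close>, the function
  \<open>\<xi>\<close> lies in the q-Wiener algebra.
\<close>

section \<open>Iterated infinite sums\<close>

lemma summable_on_product_bound:
  fixes f :: "'a \<Rightarrow> 'b \<Rightarrow> 'c::banach"
  assumes bound: "\<And>x y. norm (f x y) \<le> h x y"
    and h: "\<And>x. (h x has_sum H x) UNIV" and H: "H summable_on UNIV"
  shows "(\<lambda>(x, y). f x y) summable_on UNIV \<times> UNIV"
proof -
  have "0 \<le> h x y" for x y using norm_ge_zero order_trans bound by blast
  then have "(\<lambda>(x, y). h x y) summable_on UNIV \<times> UNIV"
    using h H by (intro summable_on_SigmaI[where g = H]) auto
  then have "(\<lambda>z. norm (case z of (x, y) \<Rightarrow> f x y)) summable_on UNIV \<times> UNIV"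
    by (rule Infinite_Sum.abs_summable_on_comparison_test') (auto simp: bound)
  then show ?thesis by (rule abs_summable_summable)
qed

lemma summable_on_columns:
  fixes f :: "'a \<Rightarrow> 'b \<Rightarrow> 'c::banach"
  assumes "(\<lambda>(x, y). f x y) summable_on UNIV \<times> UNIV"
  shows "(\<lambda>y. \<Sum>\<^sub>\<infinity>x. f x y) summable_on UNIV"
proof -
  have *: "(\<lambda>(y, x). f x y) summable_on UNIV \<times> UNIV"
    using assms by (subst (asm) summable_on_swap) (simp add: case_prod_unfold)
  show "(\<lambda>y. \<Sum>\<^sub>\<infinity>x. f x y) summable_on UNIV"
    using summable_on_Sigma_banach[OF *] by simp
qed

text \<open>
  A Fubini rule for \<open>has_sum\<close> whose hypotheses can be read off termwise: the majorant has explicit row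
  sums \<open>H\<close>, and the row and column sums of \<open>f\<close> are known. Knowing one of the two iterated sums
  then yields the other; all exchanges of summation that identify a sum go through this rule.
\<close>

lemma has_sum_exchange:
  fixes f :: "'a \<Rightarrow> 'b \<Rightarrow> 'c::banach"
  assumes "\<And>x y. norm (f x y) \<le> h x y"
    and "\<And>x. (h x has_sum H x) UNIV" and "H summable_on UNIV"
    and rows: "\<And>x. (f x has_sum R x) UNIV"
    and cols: "\<And>y. ((\<lambda>x. f x y) has_sum L y) UNIV"
  shows "(R has_sum S) UNIV \<longleftrightarrow> (L has_sum S) UNIV"
proof -
  have "(\<lambda>(x, y). f x y) summable_on UNIV \<times> UNIV"
    by (rule summable_on_product_bound) fact+
  then obtain T where T: "((\<lambda>(x, y). f x y) has_sum T) (UNIV \<times> UNIV)"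
    unfolding summable_on_def by blast
  then have T': "((\<lambda>(y, x). f x y) has_sum T) (UNIV \<times> UNIV)"
    by (subst (asm) has_sum_swap) (simp add: case_prod_unfold)
  have "(R has_sum T) UNIV" by (rule has_sum_SigmaD[OF T]) (simp add: rows)
  moreover have "(L has_sum T) UNIV" by (rule has_sum_SigmaD[OF T']) (simp add: cols)
  ultimately show ?thesis by (metis has_sum_unique)
qed

lemma has_sum_of_nat_embed:
  fixes f :: "int \<Rightarrow> 'a::{comm_monoid_add, topological_space}"
  assumes "\<And>n. n < 0 \<Longrightarrow> f n = 0"
  shows "((\<lambda>m. f (int m)) has_sum S) UNIV \<longleftrightarrow> (f has_sum S) UNIV"
proof -
  have "((\<lambda>m. f (int m)) has_sum S) UNIV \<longleftrightarrow> (f has_sum S) {0..}"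
    by (rule has_sum_reindex_bij_witness[of _ nat int]) auto
  also have "\<dots> \<longleftrightarrow> (f has_sum S) UNIV"
    using assms by (intro has_sum_cong_neutral) auto
  finally show ?thesis .
qed

lemma has_sum_int_shift:
  fixes f :: "int \<Rightarrow> 'a::{comm_monoid_add, topological_space}"
  shows "((\<lambda>n. f (n + k)) has_sum S) UNIV \<longleftrightarrow> (f has_sum S) UNIV"
  by (rule has_sum_reindex_bij_witness[of _ "\<lambda>n. n - k" "\<lambda>n. n + k"]) auto

lemma summable_on_int_shift:
  fixes f :: "int \<Rightarrow> 'a::{comm_monoid_add, topological_space}"
  shows "(\<lambda>n. f (n + k)) summable_on UNIV \<longleftrightarrow> f summable_on UNIV"
  unfolding summable_on_def has_sum_int_shift ..

lemma has_sum_finite_sum: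
  fixes f :: "'a \<Rightarrow> 'b \<Rightarrow> 'c::topological_comm_monoid_add"
  assumes "\<And>r. r \<in> A \<Longrightarrow> (f r has_sum S r) B"
  shows "((\<lambda>t. \<Sum>r\<in>A. f r t) has_sum (\<Sum>r\<in>A. S r)) B"
  using assms by (induction A rule: infinite_finite_induct) (auto intro!: has_sum_add)

section \<open>Euler's two q-exponential series\<close>

text \<open>
  On the points \<open>q^n\<close> with \<open>n\<close> an integer, the argument \<open>x t\<close> of the kernel becomes a sum of exponents
  and the measure \<open>t^(2v+1) d_q t\<close> becomes \<open>(1 - q) a^n\<close> with \<open>a = q^(2v+2)\<close>. The order \<open>v\<close> enters
  only through \<open>a\<close>, and \<open>v > -1\<close> becomes \<open>a < 1\<close>.
\<close>

locale q_bessel_lattice =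
  fixes q a :: real
  assumes q_bounds: "0 < q" "q < 1" and a_bounds: "0 < a" "a < 1"
begin

definition p :: real where "p = q\<^sup>2"

definition qfac :: "nat \<Rightarrow> real" where "qfac n = qpoch p p n"

text \<open>
  The coefficients of Euler's second series, $(z;p)_\infty = \sum_m (-1)^m p^{m(m-1)/2} z^m / (p;p)_m$;
  the exponent \<open>m (m - 1)\<close> of \<open>q\<close> is that of \<open>p^(1/2)\<close>.
\<close>

definition Qcoeff :: "nat \<Rightarrow> real" where "Qcoeff m = (-1) ^ m * q ^ (m * (m - 1)) / qfac m"

lemma p_bounds: "0 < p" "p < 1"
  using q_bounds by (auto simp: p_def power_less_one_iff)

lemma qpoch_0 [simp]: "qpoch z p 0 = 1"
  and qpoch_Suc: "qpoch z p (Suc n) = qpoch z p n * (1 - z * p ^ n)"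
  by (simp_all add: qpoch_def)

lemma mult_power_p_less_1: "0 < z \<Longrightarrow> z < 1 \<Longrightarrow> z * p ^ i < 1"
  using p_bounds by (intro le_less_trans[OF mult_left_le[of "p ^ i" z]]) (auto intro: power_le_one)

lemma qpoch_inf_tendsto:
  assumes "0 < z" "z < 1"
  shows "(\<lambda>n. qpoch z p n) \<longlonglongrightarrow> qpoch_inf z p" "0 < qpoch_inf z p"
proof -
  note small = mult_power_p_less_1[OF assms]
  have "summable (\<lambda>i. norm ((1 - z * p ^ i) - 1))"
    using p_bounds assms by (simp add: abs_mult summable_mult summable_geometric)
  then have conv: "convergent_prod (\<lambda>i. 1 - z * p ^ i)"
    by (intro abs_convergent_prod_imp_convergent_prod)
       (simp add: abs_convergent_prod_conv_summable)
  show "(\<lambda>n. qpoch z p n) \<longlonglongrightarrow> qpoch_inf z p"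
    using convergent_prod_LIMSEQ[OF conv]
    unfolding qpoch_def qpoch_inf_def by (simp add: LIMSEQ_lessThan_iff_atMost[symmetric])
  show "0 < qpoch_inf z p"
    unfolding qpoch_inf_def using conv small by (intro less_0_prodinf) auto
qed

lemma qpoch_pos: "0 < z \<Longrightarrow> z < 1 \<Longrightarrow> 0 < qpoch z p n"
  unfolding qpoch_def by (intro prod_pos) (simp add: mult_power_p_less_1)

lemma qpoch_decreasing:
  assumes "0 < z" "z < 1"
  shows "decseq (\<lambda>n. qpoch z p n)"
proof (rule decseq_SucI)
  fix n
  have "0 \<le> z * p ^ n" using assms p_bounds by simp
  then show "qpoch z p (Suc n) \<le> qpoch z p n"
    using qpoch_pos[OF assms, of n] by (simp add: qpoch_Suc mult_left_le)
qed

lemma qpoch_inf_le: "0 < z \<Longrightarrow> z < 1 \<Longrightarrow> qpoch_inf z p \<le> qpoch z p n"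
  using decseq_ge[OF qpoch_decreasing] qpoch_inf_tendsto by blast

lemma qpoch_le_1: "0 < z \<Longrightarrow> z < 1 \<Longrightarrow> qpoch z p n \<le> 1"
  using decseqD[OF qpoch_decreasing, of z 0 n] by simp

lemma qfac_pos: "0 < qfac n" and qfac_le_1: "qfac n \<le> 1" and qfac_lower: "qpoch_inf p p \<le> qfac n"
  unfolding qfac_def by (intro qpoch_pos qpoch_le_1 qpoch_inf_le p_bounds)+

lemma qfac_0 [simp]: "qfac 0 = 1" and qfac_Suc: "qfac (Suc n) = qfac n * (1 - p ^ Suc n)"
  by (simp_all add: qfac_def qpoch_Suc)

lemma power_p_neq_1: "p ^ Suc n \<noteq> 1"
  by (rule less_imp_neq) (intro power_Suc_less_one p_bounds)

text \<open>
  Euler's identities say that \<open>qexp z\<close> is $1/(z;p)_\infty$ for $|z| < 1$ and that \<open>Qexp z\<close> is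
  $(z;p)_\infty$ for all \<open>z\<close>. Both follow from a first order \<open>p\<close>-difference equation, iterated towards
  the value 1 at the origin.
\<close>

definition qexp :: "real \<Rightarrow> real" where "qexp z = (\<Sum>n. (1 / qfac n) * z ^ n)"
definition Qexp :: "real \<Rightarrow> real" where "Qexp z = (\<Sum>n. Qcoeff n * z ^ n)"

lemma summable_qexp:
  assumes "\<bar>z\<bar> < 1"
  shows "summable (\<lambda>n. \<bar>(1 / qfac n) * z ^ n\<bar>)"
proof (rule summable_comparison_test')
  show "summable (\<lambda>n. (1 / qpoch_inf p p) * \<bar>z\<bar> ^ n)"
    using assms by (simp add: summable_mult summable_geometric)
  fix n
  have "1 / qfac n \<le> 1 / qpoch_inf p p"
    using qfac_lower[of n] qpoch_inf_tendsto(2)[OF p_bounds] by (simp add: frac_le)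
  then show "norm \<bar>(1 / qfac n) * z ^ n\<bar> \<le> (1 / qpoch_inf p p) * \<bar>z\<bar> ^ n"
    using mult_right_mono[of "1 / qfac n" "1 / qpoch_inf p p" "\<bar>z\<bar> ^ n"] qfac_pos[of n]
    by (simp add: abs_mult power_abs)
qed

lemma gauss_Suc: "q ^ (Suc m * (Suc m - 1)) = q ^ (m * (m - 1)) * p ^ m"
proof -
  have "Suc m * (Suc m - 1) = m * (m - 1) + 2 * m" by (cases m) simp_all
  then show ?thesis by (simp only: p_def power_add power_mult)
qed

text \<open>
  The Gaussian factor beats every geometric sequence: consecutive terms have ratio \<open>p^m r\<close>,
  which tends to 0.
\<close>

lemma summable_gauss: "summable (\<lambda>m. q ^ (m * (m - 1)) * \<bar>r :: real\<bar> ^ m)"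
proof -
  have "(\<lambda>m. p ^ m * \<bar>r\<bar>) \<longlonglongrightarrow> 0 * \<bar>r\<bar>"
    using p_bounds by (intro tendsto_intros LIMSEQ_power_zero) auto
  then have "eventually (\<lambda>m. p ^ m * \<bar>r\<bar> < 1 / 2) sequentially"
    by (rule order_tendstoD) simp
  then obtain N where N: "\<And>m. m \<ge> N \<Longrightarrow> p ^ m * \<bar>r\<bar> < 1 / 2"
    by (auto simp: eventually_sequentially)
  show ?thesis
  proof (rule summable_ratio_test[of "1/2" N])
    fix m assume "m \<ge> N"
    have "q ^ (m * (m - 1)) * \<bar>r\<bar> ^ m * (p ^ m * \<bar>r\<bar>) \<le> q ^ (m * (m - 1)) * \<bar>r\<bar> ^ m * (1 / 2)"
      using N[OF \<open>m \<ge> N\<close>] q_bounds by (intro mult_left_mono) auto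
    then show "norm (q ^ (Suc m * (Suc m - 1)) * \<bar>r\<bar> ^ Suc m) \<le> 1 / 2 * norm (q ^ (m * (m - 1)) * \<bar>r\<bar> ^ m)"
      using q_bounds p_bounds unfolding gauss_Suc by (simp add: abs_mult mult.assoc mult.left_commute mult.commute)
  qed simp
qed

lemma qfac_step: "(1 - p ^ Suc m) / qfac (Suc m) = 1 / qfac m"
  using power_p_neq_1[of m] unfolding qfac_Suc by (simp del: power_Suc)

lemma Qcoeff_step: "Qcoeff (Suc m) * (1 - p ^ Suc m) = - (p ^ m * Qcoeff m)"
proof -
  have "Qcoeff (Suc m) * (1 - p ^ Suc m) = (-1) ^ Suc m * (q ^ (m * (m - 1)) * p ^ m) * ((1 - p ^ Suc m) / qfac (Suc m))"
    unfolding Qcoeff_def gauss_Suc by simp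
  then show ?thesis unfolding qfac_step by (simp add: Qcoeff_def)
qed

lemma abs_Qcoeff: "\<bar>Qcoeff m\<bar> = q ^ (m * (m - 1)) / qfac m"
  using qfac_pos[of m] q_bounds by (simp add: Qcoeff_def abs_mult power_abs)

lemma summable_Qexp: "summable (\<lambda>n. \<bar>Qcoeff n * z ^ n\<bar>)"
proof (rule summable_comparison_test')
  show "summable (\<lambda>m. (1 / qpoch_inf p p) * (q ^ (m * (m - 1)) * \<bar>z\<bar> ^ m))"
    by (intro summable_mult summable_gauss)
  fix n
  have "1 / qfac n \<le> 1 / qpoch_inf p p"
    using qfac_lower[of n] qpoch_inf_tendsto(2)[OF p_bounds] by (simp add: frac_le)
  then have "1 / qfac n * (q ^ (n * (n - 1)) * \<bar>z\<bar> ^ n)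
      \<le> (1 / qpoch_inf p p) * (q ^ (n * (n - 1)) * \<bar>z\<bar> ^ n)"
    using q_bounds by (intro mult_right_mono) auto
  then show "norm \<bar>Qcoeff n * z ^ n\<bar> \<le> (1 / qpoch_inf p p) * (q ^ (n * (n - 1)) * \<bar>z\<bar> ^ n)"
    using q_bounds qfac_pos[of n] by (simp add: abs_mult power_abs abs_Qcoeff)
qed

lemma sums_shift_zero:
  fixes f :: "nat \<Rightarrow> real"
  assumes "f sums s"
  shows "(\<lambda>n. case n of 0 \<Rightarrow> 0 | Suc m \<Rightarrow> f m) sums s"
proof -
  have "(\<lambda>n. case Suc n of 0 \<Rightarrow> 0 | Suc m \<Rightarrow> f m) sums s" using assms by simp
  from sums_Suc[OF this] show ?thesis by simp
qed

text \<open>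
  Coefficientwise this is $(1 - p^n)/(p;p)_n = 1/(p;p)_{n-1}$.
\<close>

lemma qexp_functional:
  assumes "\<bar>z\<bar> < 1"
  shows "qexp (p * z) = (1 - z) * qexp z"
proof -
  have S: "(\<lambda>n. (1 / qfac n) * z ^ n) sums qexp z" if "\<bar>z\<bar> < 1" for z
    unfolding qexp_def by (rule summable_sums[OF summable_rabs_cancel[OF summable_qexp[OF that]]])
  have pz: "\<bar>p * z\<bar> < 1"
    using mult_strict_mono[of p 1 "\<bar>z\<bar>" 1] assms p_bounds by (simp add: abs_mult)
  have "(\<lambda>n. case n of 0 \<Rightarrow> 0 | Suc m \<Rightarrow> z * ((1 / qfac m) * z ^ m)) sums (z * qexp z)"
    by (intro sums_shift_zero sums_mult S assms)
  from sums_diff[OF S[OF assms] this]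
  have "(\<lambda>n. (1 / qfac n) * (p * z) ^ n) sums (qexp z - z * qexp z)"
  proof (rule sums_cong[THEN iffD1, rotated])
    show "(1 / qfac n) * z ^ n - (case n of 0 \<Rightarrow> 0 | Suc m \<Rightarrow> z * ((1 / qfac m) * z ^ m))
       = (1 / qfac n) * (p * z) ^ n" for n
    proof (cases n)
      case (Suc m)
      have "(1 / qfac n) * z ^ n - z * ((1 / qfac m) * z ^ m)
          = (1 / qfac n) * z ^ n - ((1 - p ^ n) / qfac n) * z ^ n"
        unfolding Suc qfac_step by simp
      also have "\<dots> = (1 / qfac n) * (p * z) ^ n"
        by (simp add: power_mult_distrib diff_divide_distrib left_diff_distrib)
      finally show ?thesis by (simp add: Suc)
    qed simp
  qed
  from sums_unique2[OF this S[OF pz]] show ?thesis by (simp add: algebra_simps)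
qed

lemma Qexp_functional: "Qexp z = (1 - z) * Qexp (p * z)"
proof -
  have S: "(\<lambda>n. Qcoeff n * z ^ n) sums Qexp z" for z
    unfolding Qexp_def by (rule summable_sums[OF summable_rabs_cancel[OF summable_Qexp]])
  have "(\<lambda>n. case n of 0 \<Rightarrow> 0 | Suc m \<Rightarrow> z * (Qcoeff m * (p * z) ^ m)) sums (z * Qexp (p * z))"
    by (intro sums_shift_zero sums_mult S)
  from sums_diff[OF S[of "p * z"] this]
  have "(\<lambda>n. Qcoeff n * z ^ n) sums (Qexp (p * z) - z * Qexp (p * z))"
  proof (rule sums_cong[THEN iffD1, rotated])
    show "Qcoeff n * (p * z) ^ n - (case n of 0 \<Rightarrow> 0 | Suc m \<Rightarrow> z * (Qcoeff m * (p * z) ^ m))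
       = Qcoeff n * z ^ n" for n
    proof (cases n)
      case (Suc m)
      have "Qcoeff n * (p * z) ^ n - z * (Qcoeff m * (p * z) ^ m)
          = Qcoeff n * (p * z) ^ n - (p ^ m * Qcoeff m) * z ^ n"
        unfolding Suc by (simp add: power_mult_distrib)
      also have "\<dots> = Qcoeff n * (p * z) ^ n + (Qcoeff n * (1 - p ^ n)) * z ^ n"
        unfolding Suc Qcoeff_step by simp
      also have "\<dots> = Qcoeff n * z ^ n"
        by (simp add: power_mult_distrib algebra_simps)
      finally show ?thesis by (simp add: Suc)
    qed simp
  qed
  from sums_unique2[OF S this] show ?thesis by (simp add: algebra_simps)
qed

lemma power_p_mult_less_1: "\<bar>z\<bar> < 1 \<Longrightarrow> \<bar>p ^ n * z\<bar> < 1"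
  using p_bounds power_le_one[of p n] mult_right_mono[of "p ^ n" 1 "\<bar>z\<bar>"]
  by (simp add: abs_mult power_abs)

lemma qexp_shift: "\<bar>z\<bar> < 1 \<Longrightarrow> qexp (p ^ n * z) = qpoch z p n * qexp z"
proof (induction n)
  case (Suc n)
  then show ?case
    using qexp_functional[OF power_p_mult_less_1[of z n]] by (simp add: qpoch_Suc algebra_simps)
qed simp

lemma Qexp_shift: "Qexp z = qpoch z p n * Qexp (p ^ n * z)"
proof (induction n)
  case (Suc n)
  have "Qexp (p ^ n * z) = (1 - z * p ^ n) * Qexp (p ^ Suc n * z)"
    by (subst Qexp_functional) (simp add: mult.assoc mult.left_commute mult.commute)
  then show ?case
    by (subst Suc.IH) (simp add: qpoch_Suc)
qed simp

lemma qexp_tendsto: "(\<lambda>n. qexp (p ^ n * z)) \<longlonglongrightarrow> 1"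
  and Qexp_tendsto: "(\<lambda>n. Qexp (p ^ n * z)) \<longlonglongrightarrow> 1"
proof -
  have lim: "(\<lambda>n. p ^ n * z) \<longlonglongrightarrow> 0"
    using tendsto_mult[OF LIMSEQ_power_zero tendsto_const, of p z] p_bounds by simp
  have "summable (\<lambda>n. (1 / qfac n) * (1/2) ^ n)"
    by (rule summable_rabs_cancel, rule summable_qexp) simp
  then have "isCont qexp 0"
    unfolding qexp_def by (rule isCont_powser) simp
  moreover have "qexp 0 = 1" unfolding qexp_def powser_zero by simp
  ultimately show "(\<lambda>n. qexp (p ^ n * z)) \<longlonglongrightarrow> 1"
    using isCont_tendsto_compose[OF _ lim] by metis
  have "summable (\<lambda>n. Qcoeff n * 1 ^ n)"
    by (rule summable_rabs_cancel, rule summable_Qexp)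
  then have "isCont Qexp 0"
    unfolding Qexp_def by (rule isCont_powser) simp
  moreover have "Qexp 0 = 1" unfolding Qexp_def powser_zero by (simp add: Qcoeff_def)
  ultimately show "(\<lambda>n. Qexp (p ^ n * z)) \<longlonglongrightarrow> 1"
    using isCont_tendsto_compose[OF _ lim] by metis
qed

lemma qexp_eq:
  assumes "0 < z" "z < 1"
  shows "qexp z = 1 / qpoch_inf z p"
proof -
  have "(\<lambda>n. qpoch z p n * qexp z) \<longlonglongrightarrow> qpoch_inf z p * qexp z"
    by (intro tendsto_intros qpoch_inf_tendsto assms)
  moreover have "(\<lambda>n. qpoch z p n * qexp z) \<longlonglongrightarrow> 1"
    using qexp_tendsto[of z] assms by (simp add: qexp_shift)
  ultimately have "qpoch_inf z p * qexp z = 1" by (rule LIMSEQ_unique)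
  then show ?thesis using qpoch_inf_tendsto(2)[OF assms] by (simp add: field_simps)
qed

lemma Qexp_eq:
  assumes "0 < z" "z < 1"
  shows "Qexp z = qpoch_inf z p"
proof -
  have "(\<lambda>n. qpoch z p n * Qexp (p ^ n * z)) \<longlonglongrightarrow> qpoch_inf z p * 1"
    by (intro tendsto_intros qpoch_inf_tendsto Qexp_tendsto assms)
  then have "(\<lambda>n. Qexp z) \<longlonglongrightarrow> qpoch_inf z p"
    by (simp only: Qexp_shift[symmetric] mult_1_right)
  then show ?thesis by (simp add: LIMSEQ_const_iff)
qed

text \<open>
  The values of \<open>Qexp\<close> at powers of \<open>p\<close>: at nonpositive powers a factor of the infinite product
  vanishes, at positive powers the product is a tail of $(p;p)_\infty$.
\<close>

lemma Qexp_power: "Qexp (p ^ Suc n) = qpoch_inf p p / qfac n"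
proof -
  have "qfac n * Qexp (p ^ n * p) = qpoch_inf p p"
    by (simp only: qfac_def Qexp_shift[symmetric] Qexp_eq[OF p_bounds])
  then show ?thesis using qfac_pos[of n] by (simp add: field_simps)
qed

lemma Qexp_power_neg: "Qexp (p powi (- int n)) = 0"
proof -
  have "qpoch (p powi (- int n)) p (Suc n) = 0"
    using p_bounds by (simp add: qpoch_Suc power_int_minus)
  then show ?thesis by (subst Qexp_shift[of _ "Suc n"]) simp
qed

text \<open>
  The two Euler series are inverse to each other as formal power series. The convolution \<open>h n\<close>
  is computed directly: splitting $1 - p^n = (1 - p^m) + p^m (1 - p^{n-m})$ and applying the two
  coefficient recursions makes $(1 - p^n) h_n$ telescope to 0.
\<close>

lemma Qcoeff_inverse: "(\<Sum>m\<le>n. Qcoeff m / qfac (n - m)) = (if n = 0 then 1 else 0)"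
proof (cases n)
  case (Suc k)
  have split: "(1 - p ^ n) * (Qcoeff m / qfac (n - m)) =
      (1 - p ^ m) * Qcoeff m / qfac (n - m) + p ^ m * Qcoeff m * ((1 - p ^ (n - m)) / qfac (n - m))" if "m \<le> n" for m
  proof -
    have "p ^ n = p ^ m * p ^ (n - m)" using that by (simp flip: power_add)
    then show ?thesis by (simp add: diff_divide_distrib algebra_simps)
  qed
  have cS: "(1 - p ^ Suc m) * Qcoeff (Suc m) = - (p ^ m * Qcoeff m)" for m
    using Qcoeff_step[of m] by (simp only: mult.commute)
  have A: "(\<Sum>m\<le>n. (1 - p ^ m) * Qcoeff m / qfac (n - m)) = (\<Sum>m\<le>k. - (p ^ m * Qcoeff m) / qfac (k - m))"
    unfolding Suc sum.atMost_Suc_shift by (simp add: cS del: power_Suc)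
  have B: "(\<Sum>m\<le>n. p ^ m * Qcoeff m * ((1 - p ^ (n - m)) / qfac (n - m))) = (\<Sum>m\<le>k. p ^ m * Qcoeff m / qfac (k - m))"
    unfolding Suc sum.atMost_Suc
    by (simp add: Suc_diff_le qfac_step del: power_Suc)
  have "(1 - p ^ n) * (\<Sum>m\<le>n. Qcoeff m / qfac (n - m)) = 0"
  proof -
    have "(1 - p ^ n) * (\<Sum>m\<le>n. Qcoeff m / qfac (n - m)) = (\<Sum>m\<le>n. (1 - p ^ m) * Qcoeff m / qfac (n - m)
        + p ^ m * Qcoeff m * ((1 - p ^ (n - m)) / qfac (n - m)))"
      unfolding sum_distrib_left by (intro sum.cong refl split) simp
    also have "\<dots> = (\<Sum>m\<le>k. - (p ^ m * Qcoeff m) / qfac (k - m)) + (\<Sum>m\<le>k. p ^ m * Qcoeff m / qfac (k - m))"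
      unfolding sum.distrib A B ..
    also have "\<dots> = 0" by (simp add: sum_negf)
    finally show ?thesis .
  qed
  then show ?thesis using power_p_neq_1[of k] Suc by simp
qed (simp add: Qcoeff_def)

section \<open>The Hahn-Exton kernel on the lattice\<close>

text \<open>
  Equal to $(1-q)\, c_{q,v}$ when \<open>a = q^(2v+2)\<close>: the factor of Jackson's integral is absorbed.
\<close>

definition C :: real where "C = qpoch_inf a p / qpoch_inf p p"

text \<open>
  The function $x \mapsto (q^2 x^2; q^2)_\infty / (q^2;q^2)_\infty$ at \<open>x = q^n\<close>. It is
  nonnegative, vanishes for \<open>x > 1\<close>, increases to a positive limit as \<open>x\<close> tends to 0, and turns
  out to be its own Bessel transform; for these reasons it can play the role of a Gaussian.
\<close>

definition K :: "int \<Rightarrow> real" where "K n = (if n < 0 then 0 else 1 / qfac (nat n))"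

definition J :: "int \<Rightarrow> real" where
  "J i = (\<Sum>m. (-1) ^ m * q ^ (m * (m + 1)) / (qpoch p p m * qpoch a p m) * (q powi i) ^ (2 * m))"

definition bessel_fourier :: "(int \<Rightarrow> 'a::banach) \<Rightarrow> int \<Rightarrow> 'a" where
  "bessel_fourier f i = (\<Sum>\<^sub>\<infinity>n. (C * a powi n * J (i + n)) *\<^sub>R f n)"

lemma C_pos: "0 < C"
  using qpoch_inf_tendsto(2) p_bounds a_bounds by (simp add: C_def)

lemma K_neg [simp]: "n < 0 \<Longrightarrow> K n = 0"
  by (simp add: K_def)

lemma K_of_nat [simp]: "K (int m) = 1 / qfac m"
  by (simp add: K_def)

lemma K_nonneg: "0 \<le> K n"
  using qfac_pos by (simp add: K_def less_imp_le)

lemma K_ge_1: "0 \<le> n \<Longrightarrow> 1 \<le> K n"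
  using qfac_pos[of "nat n"] qfac_le_1[of "nat n"] by (simp add: K_def)

lemma K_le: "K n \<le> 1 / qpoch_inf p p"
  using qfac_lower[of "nat n"] qpoch_inf_tendsto(2)[OF p_bounds]
  by (simp add: K_def frac_le)

lemma K_moment:
  assumes "0 < z" "z < 1"
  shows "((\<lambda>n. z powi n * K n) has_sum qexp z) UNIV"
proof (subst has_sum_of_nat_embed[symmetric])
  have z: "\<bar>z\<bar> < 1" using assms by simp
  have "(\<lambda>n. (1 / qfac n) * z ^ n) sums qexp z"
    unfolding qexp_def by (rule summable_sums[OF summable_rabs_cancel[OF summable_qexp[OF z]]])
  then have "((\<lambda>n. (1 / qfac n) * z ^ n) has_sum qexp z) UNIV"
    using summable_qexp[OF z] by (intro norm_summable_imp_has_sum) simp_all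
  then show "((\<lambda>m. z powi int m * K (int m)) has_sum qexp z) UNIV"
    by (simp add: mult.commute)
qed simp

lemma Qexp_has_sum: "((\<lambda>m. Qcoeff m * z ^ m) has_sum Qexp z) UNIV"
proof -
  have "(\<lambda>m. Qcoeff m * z ^ m) sums Qexp z"
    unfolding Qexp_def by (rule summable_sums[OF summable_rabs_cancel[OF summable_Qexp]])
  then show ?thesis
    using summable_Qexp[of z] by (intro norm_summable_imp_has_sum) simp_all
qed

lemma Qexp_abs_summable_on: "(\<lambda>m. \<bar>Qcoeff m\<bar> * \<bar>z\<bar> ^ m) summable_on UNIV"
  using norm_summable_imp_summable_on[of "\<lambda>m. \<bar>Qcoeff m * z ^ m\<bar>"] summable_Qexp[of z]
  by (simp add: abs_mult power_abs)

lemma Qexp_p_powi: "Qexp (p powi (i + 1)) / qpoch_inf p p = K i"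
proof (cases "i < 0")
  case True
  then have "i + 1 = - int (nat (- (i + 1)))" by simp
  then have "Qexp (p powi (i + 1)) = 0" using Qexp_power_neg by metis
  then show ?thesis using True by simp
next
  case False
  then obtain n where n: "i = int n" by (metis nonneg_int_cases not_less)
  have "p powi (int n + 1) = p ^ Suc n"
    using power_int_of_nat[of p "Suc n"] by (simp add: add.commute)
  then show ?thesis
    unfolding n using Qexp_power[of n] qpoch_inf_tendsto(2)[OF p_bounds] by simp
qed

lemma K_inverse: "((\<lambda>m. Qcoeff m * K (n - int m)) has_sum (if n = 0 then 1 else 0)) UNIV"
proof (cases "n < 0")
  case True
  then show ?thesis by (intro has_sum_finite_neutralI[of "{}"]) auto
next
  case False
  then obtain k where k: "n = int k" by (metis nonneg_int_cases not_less)
  show ?thesis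
  proof (rule has_sum_finite_neutralI[of "{..k}"])
    have "(\<Sum>m\<le>k. Qcoeff m * K (n - int m)) = (\<Sum>m\<le>k. Qcoeff m / qfac (k - m))"
      by (intro sum.cong refl) (simp add: k K_def nat_diff_distrib)
    then show "(if n = 0 then 1 else 0) = (\<Sum>m\<le>k. Qcoeff m * K (n - int m))"
      by (simp add: Qcoeff_inverse k)
  qed (auto simp: k)
qed

text \<open>
  The terms of the Bessel series, written so that the coefficients of Euler's second series are
  visible.
\<close>

definition J_term :: "int \<Rightarrow> nat \<Rightarrow> real" where
  "J_term i m = Qcoeff m / qpoch a p m * (p powi (i + 1)) ^ m"

lemma J_term_bound: "\<bar>J_term i m\<bar> \<le> 1 / qpoch_inf a p * (\<bar>Qcoeff m\<bar> * \<bar>p powi (i + 1)\<bar> ^ m)"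
proof -
  have "1 / qpoch a p m \<le> 1 / qpoch_inf a p"
    using qpoch_inf_le[OF a_bounds, of m] qpoch_inf_tendsto(2)[OF a_bounds] by (simp add: frac_le)
  then have "1 / qpoch a p m * (\<bar>Qcoeff m\<bar> * \<bar>p powi (i + 1)\<bar> ^ m)
      \<le> 1 / qpoch_inf a p * (\<bar>Qcoeff m\<bar> * \<bar>p powi (i + 1)\<bar> ^ m)"
    by (rule mult_right_mono) simp
  moreover have "\<bar>J_term i m\<bar> = 1 / qpoch a p m * (\<bar>Qcoeff m\<bar> * \<bar>p powi (i + 1)\<bar> ^ m)"
    using qpoch_pos[OF a_bounds, of m] by (simp add: J_term_def abs_mult power_abs)
  ultimately show ?thesis by simp
qed

lemma J_term_summable: "summable (\<lambda>m. \<bar>J_term i m\<bar>)"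
proof (rule summable_comparison_test')
  show "summable (\<lambda>m. 1 / qpoch_inf a p * (\<bar>Qcoeff m\<bar> * \<bar>p powi (i + 1)\<bar> ^ m))"
    using summable_Qexp[of "p powi (i + 1)"] by (intro summable_mult) (simp add: abs_mult power_abs)
  show "norm \<bar>J_term i m\<bar> \<le> 1 / qpoch_inf a p * (\<bar>Qcoeff m\<bar> * \<bar>p powi (i + 1)\<bar> ^ m)" for m
    using J_term_bound by simp
qed

lemma J_term_abs_summable_on: "(\<lambda>m. \<bar>J_term i m\<bar>) summable_on UNIV"
  using norm_summable_imp_summable_on[of "\<lambda>m. \<bar>J_term i m\<bar>"] J_term_summable by simp

lemma J_eq_suminf: "J i = (\<Sum>m. J_term i m)"
proof -
  have "(-1) ^ m * q ^ (m * (m + 1)) / (qpoch p p m * qpoch a p m) * (q powi i) ^ (2 * m) = J_term i m" for m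
  proof -
    have "m * (m + 1) = m * (m - 1) + 2 * m" by (cases m) simp_all
    then have "q ^ (m * (m + 1)) = q ^ (m * (m - 1)) * p ^ m"
      by (simp only: p_def power_add power_mult)
    moreover have "(q powi i) ^ (2 * m) = (p powi i) ^ m"
      by (simp add: p_def power_mult power_int_power' power_int_power mult.commute mult.left_commute)
    moreover have "p powi (i + 1) = p powi i * p"
      using p_bounds by (simp add: power_int_add)
    ultimately show ?thesis by (simp add: J_term_def Qcoeff_def qfac_def power_mult_distrib)
  qed
  then show ?thesis by (simp add: J_def)
qed

lemma J_has_sum: "(J_term i has_sum J i) UNIV"
proof -
  have "J_term i sums J i"
    unfolding J_eq_suminf by (rule summable_sums[OF summable_rabs_cancel[OF J_term_summable]])
  then show ?thesis using J_term_summable by (intro norm_summable_imp_has_sum) simp_all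
qed

lemma J_term_shift: "J_term (i + int n) m = J_term i m * (p ^ n) ^ m"
proof -
  have "p powi (i + int n + 1) = p powi (i + 1) * p ^ n"
    using p_bounds power_int_add[of p "i + 1" "int n"] by (simp add: add.commute add.left_commute)
  then show ?thesis by (simp add: J_term_def power_mult_distrib)
qed

text \<open>
  Moving towards the origin decreases every term of the series. On a right half-line of exponents this gives
  a bound for \<open>J\<close> that is good enough to start with; a uniform bound on the whole lattice has to wait
  for the expansion of \<open>J\<close> in translates of \<open>K\<close>, since the terms grow without bound to the left.
\<close>

lemma J_term_shift_le: "0 \<le> n \<Longrightarrow> \<bar>J_term (i + n) m\<bar> \<le> \<bar>J_term i m\<bar>"
proof -
  assume "0 \<le> n"
  then obtain k where k: "n = int k" by (metis nonneg_int_cases)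
  have "(p ^ k) ^ m \<le> 1" using p_bounds by (intro power_le_one) auto
  then show ?thesis
    unfolding k J_term_shift abs_mult using p_bounds by (simp add: mult_left_le)
qed

lemma J_right_bound: "0 \<le> n \<Longrightarrow> \<bar>J (i + n)\<bar> \<le> (\<Sum>\<^sub>\<infinity>m. \<bar>J_term i m\<bar>)"
  using norm_infsum_le[OF J_has_sum has_sum_infsum[OF J_term_abs_summable_on], of "i + n" i]
    J_term_shift_le by simp

lemma a_powi_pos: "0 < a powi n"
  using a_bounds by simp

lemma a_powi_add: "a powi (m + n) = a powi m * a powi n"
  using a_bounds by (simp add: power_int_add)

lemma K_weighted: "((\<lambda>n. a powi n * K n) has_sum qexp a) UNIV"
  using K_moment a_bounds by simp

lemma K_weighted_shift: "((\<lambda>n. a powi (n + k) * K (n + k)) has_sum qexp a) UNIV"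
  using has_sum_int_shift[of "\<lambda>n. a powi n * K n" k] K_weighted by simp

text \<open>
  Insert the Bessel series and sum over the lattice first. The sum over \<open>n\<close> is \<open>qexp (a p^m)\<close>,
  whose factor $(a;p)_m$ cancels the denominator $(q^{2v+2};q^2)_m$ of the Bessel series. What remains is
  Euler's second series at $p^{i+1}$, that is, \<open>K i\<close> again.
\<close>

lemma bessel_fourier_K: "((\<lambda>n. C * a powi n * J (i + n) * K n) has_sum K i) UNIV"
proof -
  define f where "f m n = C * (J_term (i + n) m * (a powi n * K n))" for m :: nat and n :: int
  define h where "h m n = C * (\<bar>J_term i m\<bar> * (a powi n * K n))" for m :: nat and n :: int
  define R where "R m = Qcoeff m * (p powi (i + 1)) ^ m * (C * qexp a)" for m
  have w: "0 \<le> a powi n * K n" for n using a_powi_pos K_nonneg by (simp add: less_imp_le)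
  have bound: "norm (f m n) \<le> h m n" for m n
  proof (cases "n < 0")
    case False
    then have "\<bar>J_term (i + n) m\<bar> * (a powi n * K n) \<le> \<bar>J_term i m\<bar> * (a powi n * K n)"
      using w by (intro mult_right_mono J_term_shift_le) auto
    then show ?thesis
      using C_pos a_powi_pos[of n] K_nonneg[of n] by (simp add: f_def h_def abs_mult)
  qed (simp add: f_def h_def)
  have h: "(h m has_sum (C * (\<bar>J_term i m\<bar> * qexp a))) UNIV" for m
    unfolding h_def by (intro has_sum_cmult_right K_weighted)
  have H: "(\<lambda>m. C * (\<bar>J_term i m\<bar> * qexp a)) summable_on UNIV"
    by (intro summable_on_cmult_right summable_on_cmult_left J_term_abs_summable_on)
  have rows: "(f m has_sum R m) UNIV" for m
  proof -
    have ap: "0 < a * p ^ m" "a * p ^ m < 1"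
      using a_bounds p_bounds mult_power_p_less_1 by auto
    have "((\<lambda>n. C * J_term i m * ((a * p ^ m) powi n * K n)) has_sum C * J_term i m * qexp (a * p ^ m)) UNIV"
      by (intro has_sum_cmult_right K_moment ap)
    moreover have "C * J_term i m * ((a * p ^ m) powi n * K n) = f m n" for n
    proof (cases "n < 0")
      case False
      then obtain k where k: "n = int k" by (metis nonneg_int_cases not_less)
      show ?thesis
        unfolding k f_def J_term_shift
        by (simp add: power_mult_distrib power_mult[symmetric] mult.commute mult.left_commute)
    qed (simp add: f_def)
    moreover have "C * J_term i m * qexp (a * p ^ m) = R m"
      using qexp_shift[of a m] a_bounds qpoch_pos[OF a_bounds, of m]
      by (simp add: J_term_def R_def mult.commute)
    ultimately show ?thesis by simp
  qed
  have cols: "((\<lambda>m. f m n) has_sum (C * a powi n * J (i + n) * K n)) UNIV" for n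
  proof -
    have "((\<lambda>m. C * (J_term (i + n) m * (a powi n * K n))) has_sum C * (J (i + n) * (a powi n * K n))) UNIV"
      by (intro has_sum_cmult_right has_sum_cmult_left J_has_sum)
    then show ?thesis by (simp add: f_def mult_ac)
  qed
  have "(R has_sum Qexp (p powi (i + 1)) * (C * qexp a)) UNIV"
    unfolding R_def by (intro has_sum_cmult_left Qexp_has_sum)
  moreover have "Qexp (p powi (i + 1)) * (C * qexp a) = K i"
    using qexp_eq[OF a_bounds] qpoch_inf_tendsto(2)[OF a_bounds]
    by (simp add: C_def Qexp_p_powi[symmetric])
  ultimately show ?thesis
    using has_sum_exchange[OF bound h H rows cols] by simp
qed

lemma bessel_fourier_K_shift:
  "((\<lambda>n. C * a powi n * J (i + n) * K (n + k)) has_sum a powi (- k) * K (i - k)) UNIV"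
proof -
  have "((\<lambda>n. a powi (- k) * (C * a powi n * J (i - k + n) * K n)) has_sum a powi (- k) * K (i - k)) UNIV"
    by (intro has_sum_cmult_right bessel_fourier_K)
  then have "((\<lambda>n. a powi (- k) * (C * a powi (n + k) * J (i - k + (n + k)) * K (n + k)))
      has_sum a powi (- k) * K (i - k)) UNIV"
    by (subst has_sum_int_shift)
  moreover have "a powi (- k) * (C * a powi (n + k) * J (i - k + (n + k)) * K (n + k))
      = C * a powi n * J (i + n) * K (n + k)" for n
    using a_powi_add[of "n + k" "- k"] by (simp add: mult_ac)
  ultimately show ?thesis by (simp only:)
qed

text \<open>
  A unit mass at 0 is the combination \<open>\<Sum>m. Qcoeff m * K (n - m)\<close> of translates of \<open>K\<close>, because the two
  Euler series are inverse to each other. Its Bessel transform is \<open>C * J\<close>; transforming the translates of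
  \<open>K\<close> one by one gives another series for \<open>J\<close>. Unlike the defining series it can be estimated at
  large arguments, as \<open>K\<close> vanishes there.
\<close>

lemma J_expansion: "((\<lambda>m. Qcoeff m * a ^ m * K (i + int m)) has_sum C * J i) UNIV"
proof -
  define B where "B = (\<Sum>\<^sub>\<infinity>m. \<bar>J_term i m\<bar>)"
  define f where "f m n = Qcoeff m * (C * a powi n * J (i + n) * K (n - int m))" for m n
  define h where "h m n = (C * B) * (\<bar>Qcoeff m\<bar> * \<bar>a\<bar> ^ m * (a powi (n + - int m) * K (n + - int m)))" for m n
  have bound: "norm (f m n) \<le> h m n" for m n
  proof (cases "n < 0")
    case False
    have "a powi n = a ^ m * a powi (n - int m)"
      using a_powi_add[of "int m" "n - int m"] by simp
    moreover have "\<bar>J (i + n)\<bar> \<le> B" unfolding B_def using False by (intro J_right_bound) simp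
    then have "\<bar>Qcoeff m\<bar> * C * (a ^ m * a powi (n - int m)) * K (n - int m) * \<bar>J (i + n)\<bar>
        \<le> \<bar>Qcoeff m\<bar> * C * (a ^ m * a powi (n - int m)) * K (n - int m) * B"
      using C_pos a_bounds K_nonneg by (intro mult_left_mono) (auto simp: less_imp_le)
    ultimately show ?thesis
      using C_pos a_bounds K_nonneg[of "n - int m"]
      by (simp add: f_def h_def abs_mult mult_ac)
  qed (simp add: f_def h_def)
  have h: "(h m has_sum (C * B * (\<bar>Qcoeff m\<bar> * \<bar>a\<bar> ^ m * qexp a))) UNIV" for m
    unfolding h_def by (intro has_sum_cmult_right K_weighted_shift)
  have H: "(\<lambda>m. C * B * (\<bar>Qcoeff m\<bar> * \<bar>a\<bar> ^ m * qexp a)) summable_on UNIV"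
    by (intro summable_on_cmult_right summable_on_cmult_left Qexp_abs_summable_on)
  have rows: "(f m has_sum (Qcoeff m * a ^ m * K (i + int m))) UNIV" for m
  proof -
    have "f m = (\<lambda>n. Qcoeff m * (C * a powi n * J (i + n) * K (n + - int m)))"
      by (rule ext) (simp add: f_def)
    then show ?thesis
      using has_sum_cmult_right[OF bessel_fourier_K_shift[of i "- int m"], of "Qcoeff m"]
      by (simp add: mult.assoc)
  qed
  have cols: "((\<lambda>m. f m n) has_sum (C * a powi n * J (i + n) * (if n = 0 then 1 else 0))) UNIV" for n
    using has_sum_cmult_right[OF K_inverse[of n], of "C * a powi n * J (i + n)"]
    by (simp add: f_def mult_ac)
  have "((\<lambda>n. C * a powi n * J (i + n) * (if n = 0 then 1 else 0)) has_sum C * J i) UNIV"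
    by (rule has_sum_finite_neutralI[of "{0}"]) auto
  then show ?thesis
    using has_sum_exchange[OF bound h H rows cols] by simp
qed

lemma J_le: "C * \<bar>J i\<bar> \<le> (\<Sum>\<^sub>\<infinity>m. \<bar>Qcoeff m\<bar> * \<bar>a\<bar> ^ m * K (i + int m))"
  and J_majorant_summable: "(\<lambda>m. \<bar>Qcoeff m\<bar> * \<bar>a\<bar> ^ m * K (i + int m)) summable_on UNIV"
proof -
  have "(\<lambda>m. \<bar>Qcoeff m\<bar> * \<bar>a\<bar> ^ m * (1 / qpoch_inf p p)) summable_on UNIV"
    by (intro summable_on_cmult_left Qexp_abs_summable_on)
  then show S: "(\<lambda>m. \<bar>Qcoeff m\<bar> * \<bar>a\<bar> ^ m * K (i + int m)) summable_on UNIV"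
    by (rule summable_on_comparison_test) (use K_nonneg in \<open>auto intro!: mult_left_mono[OF K_le] simp del: times_divide_eq_right\<close>)
  have "norm (Qcoeff m * a ^ m * K (i + int m)) \<le> \<bar>Qcoeff m\<bar> * \<bar>a\<bar> ^ m * K (i + int m)" for m
    using K_nonneg by (simp add: abs_mult power_abs)
  then have "norm (C * J i) \<le> (\<Sum>\<^sub>\<infinity>m. \<bar>Qcoeff m\<bar> * \<bar>a\<bar> ^ m * K (i + int m))"
    by (intro norm_infsum_le[OF J_expansion has_sum_infsum[OF S]])
  then show "C * \<bar>J i\<bar> \<le> (\<Sum>\<^sub>\<infinity>m. \<bar>Qcoeff m\<bar> * \<bar>a\<bar> ^ m * K (i + int m))"
    using C_pos by (simp add: abs_mult)
qed

lemma J_bounded: obtains M where "0 < M" "\<And>i. \<bar>J i\<bar> \<le> M"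
proof -
  define M where "M = (\<Sum>\<^sub>\<infinity>m. \<bar>Qcoeff m\<bar> * \<bar>a\<bar> ^ m * (1 / qpoch_inf p p)) / C"
  have S: "(\<lambda>m. \<bar>Qcoeff m\<bar> * \<bar>a\<bar> ^ m * (1 / qpoch_inf p p)) summable_on UNIV"
    by (intro summable_on_cmult_left Qexp_abs_summable_on)
  have "\<bar>J i\<bar> \<le> M" for i
  proof -
    have "C * \<bar>J i\<bar> \<le> (\<Sum>\<^sub>\<infinity>m. \<bar>Qcoeff m\<bar> * \<bar>a\<bar> ^ m * K (i + int m))" by (rule J_le)
    also have "\<dots> \<le> (\<Sum>\<^sub>\<infinity>m. \<bar>Qcoeff m\<bar> * \<bar>a\<bar> ^ m * (1 / qpoch_inf p p))"
      by (intro infsum_mono J_majorant_summable S mult_left_mono K_le) auto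
    finally show ?thesis using C_pos by (simp add: M_def field_simps)
  qed
  then have "\<bar>J i\<bar> \<le> max 1 M" for i using le_max_iff_disj by blast
  then show ?thesis using that[of "max 1 M"] by simp
qed

text \<open>
  Every translate of \<open>K\<close> has a finite weighted sum, and the coefficients of the expansion of \<open>J\<close> are
  summable.
\<close>

lemma J_weighted_summable: "(\<lambda>n. a powi n * \<bar>J (n + k)\<bar>) summable_on UNIV"
proof -
  define h where "h m n = \<bar>Qcoeff m\<bar> * (a powi (n + int m) * K (n + int m))" for m n
  have eq: "h m n = a powi n * (\<bar>Qcoeff m\<bar> * \<bar>a\<bar> ^ m * K (n + int m))" for m n
    using a_powi_add[of n "int m"] a_bounds by (simp add: h_def mult_ac)
  have h: "(h m has_sum (\<bar>Qcoeff m\<bar> * qexp a)) UNIV" for m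
    unfolding h_def by (intro has_sum_cmult_right K_weighted_shift)
  have H: "(\<lambda>m. \<bar>Qcoeff m\<bar> * qexp a) summable_on UNIV"
    using summable_on_cmult_left[OF Qexp_abs_summable_on[of 1]] by simp
  have nn: "norm (h m n) \<le> h m n" for m n
    using K_nonneg a_powi_pos by (simp add: h_def abs_mult less_imp_le)
  have "(\<lambda>n. \<Sum>\<^sub>\<infinity>m. h m n) summable_on UNIV"
    by (rule summable_on_columns[OF summable_on_product_bound[OF nn h H]])
  then have S: "(\<lambda>n. (1 / C) * (\<Sum>\<^sub>\<infinity>m. h m n)) summable_on UNIV"
    by (rule summable_on_cmult_right)
  have "(\<lambda>n. a powi n * \<bar>J n\<bar>) summable_on UNIV"
  proof (rule summable_on_comparison_test[OF S])
    fix n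
    have "(\<Sum>\<^sub>\<infinity>m. h m n) = a powi n * (\<Sum>\<^sub>\<infinity>m. \<bar>Qcoeff m\<bar> * \<bar>a\<bar> ^ m * K (n + int m))"
      unfolding eq by (intro infsum_cmult_right J_majorant_summable)
    moreover have "a powi n * (C * \<bar>J n\<bar>) \<le> a powi n * (\<Sum>\<^sub>\<infinity>m. \<bar>Qcoeff m\<bar> * \<bar>a\<bar> ^ m * K (n + int m))"
      using J_le a_powi_pos by (intro mult_left_mono) (auto simp: less_imp_le)
    ultimately show "a powi n * \<bar>J n\<bar> \<le> (1 / C) * (\<Sum>\<^sub>\<infinity>m. h m n)"
      using C_pos by (simp add: field_simps)
  qed (use a_powi_pos in \<open>simp add: less_imp_le\<close>)
  then have "(\<lambda>n. a powi (n + k) * \<bar>J (n + k)\<bar>) summable_on UNIV"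
    by (subst summable_on_int_shift)
  then have "(\<lambda>n. a powi (- k) * (a powi (n + k) * \<bar>J (n + k)\<bar>)) summable_on UNIV"
    by (rule summable_on_cmult_right)
  moreover have "a powi (- k) * (a powi (n + k) * \<bar>J (n + k)\<bar>) = a powi n * \<bar>J (n + k)\<bar>" for n
    using a_powi_add[of "n + k" "- k"] by (simp add: mult_ac)
  ultimately show ?thesis by simp
qed

text \<open>
  The transform of \<open>C * J\<close>, expanded in translates of \<open>K\<close>: each is transformed by the self-duality
  of \<open>K\<close>, and the results recombine to the unit mass from which \<open>J\<close> came.
\<close>

lemma J_orthogonal_one:
  "((\<lambda>n. C * a powi n * J n * (C * J (n + d))) has_sum (if d = 0 then 1 else 0)) UNIV"
proof -
  obtain M where M: "0 < M" "\<And>i. \<bar>J i\<bar> \<le> M" using J_bounded by blast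
  define f where "f m n = Qcoeff m * (C * a powi (n + int m) * J (n + d) * K (n + int m))" for m n
  define h where "h m n = C * M * (\<bar>Qcoeff m\<bar> * (a powi (n + int m) * K (n + int m)))" for m n
  have bound: "norm (f m n) \<le> h m n" for m n
  proof -
    have "\<bar>Qcoeff m\<bar> * C * a powi (n + int m) * K (n + int m) * \<bar>J (n + d)\<bar>
        \<le> \<bar>Qcoeff m\<bar> * C * a powi (n + int m) * K (n + int m) * M"
      using C_pos a_bounds K_nonneg M by (intro mult_left_mono) (auto simp: less_imp_le)
    then show ?thesis
      using C_pos a_bounds K_nonneg[of "n + int m"]
      by (simp add: f_def h_def abs_mult mult_ac)
  qed
  have h: "(h m has_sum (C * M * (\<bar>Qcoeff m\<bar> * qexp a))) UNIV" for m
    unfolding h_def by (intro has_sum_cmult_right K_weighted_shift)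
  have H: "(\<lambda>m. C * M * (\<bar>Qcoeff m\<bar> * qexp a)) summable_on UNIV"
    using summable_on_cmult_right[OF summable_on_cmult_left[OF Qexp_abs_summable_on[of 1]]] by simp
  have rows: "(f m has_sum (Qcoeff m * K (d - int m))) UNIV" for m
  proof -
    have "((\<lambda>n. C * a powi (n + int m) * J (d - int m + (n + int m)) * K (n + int m))
        has_sum K (d - int m)) UNIV"
      using has_sum_int_shift[of "\<lambda>n. C * a powi n * J (d - int m + n) * K n" "int m"]
        bessel_fourier_K by simp
    moreover have "f m = (\<lambda>n. Qcoeff m * (C * a powi (n + int m) * J (d - int m + (n + int m)) * K (n + int m)))"
      by (rule ext) (simp add: f_def add.commute)
    ultimately show ?thesis by (simp only: has_sum_cmult_right)
  qed
  have cols: "((\<lambda>m. f m n) has_sum (C * a powi n * J n * (C * J (n + d)))) UNIV" for n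
  proof -
    have "((\<lambda>m. C * a powi n * J (n + d) * (Qcoeff m * a ^ m * K (n + int m)))
        has_sum C * a powi n * J (n + d) * (C * J n)) UNIV"
      by (intro has_sum_cmult_right J_expansion)
    moreover have "C * a powi n * J (n + d) * (Qcoeff m * a ^ m * K (n + int m)) = f m n" for m
      using a_powi_add[of n "int m"] by (simp add: f_def mult_ac)
    ultimately show ?thesis by (simp add: mult_ac)
  qed
  show ?thesis
    using has_sum_exchange[OF bound h H rows cols] K_inverse[of d] by simp
qed

lemma J_orthogonal:
  "((\<lambda>n. C\<^sup>2 * a powi n * (J (x + n) * J (y + n))) has_sum (if x = y then a powi (- x) else 0)) UNIV"
proof -
  have "((\<lambda>n. a powi (- x) * (C * a powi (n + x) * J (n + x) * (C * J (n + x + (y - x)))))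
     has_sum a powi (- x) * (if y - x = 0 then 1 else 0)) UNIV"
    by (intro has_sum_cmult_right J_orthogonal_one
        iffD2[OF has_sum_int_shift[of "\<lambda>n. C * a powi n * J n * (C * J (n + (y - x)))" x]])
  moreover have "a powi (- x) * (C * a powi (n + x) * J (n + x) * (C * J (n + x + (y - x))))
      = C\<^sup>2 * a powi n * (J (x + n) * J (y + n))" for n
  proof -
    have "a powi n = a powi (- x) * a powi (n + x)"
      using a_powi_add[of "- x" "n + x"] by simp
    moreover have "J (n + x) = J (x + n)" "J (n + x + (y - x)) = J (y + n)"
      by (simp_all add: add.commute)
    ultimately show ?thesis by (simp only: power2_eq_square mult_ac)
  qed
  ultimately show ?thesis by (auto split: if_splits)
qed

section \<open>The Bessel transform, positivity and summability\<close>

lemma bessel_fourier_has_sum: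
  fixes f :: "int \<Rightarrow> 'a::banach"
  assumes "(\<lambda>n. a powi n * norm (f n)) summable_on UNIV"
  shows "((\<lambda>n. (C * a powi n * J (i + n)) *\<^sub>R f n) has_sum bessel_fourier f i) UNIV"
    and "\<exists>M. \<forall>i. norm (bessel_fourier f i) \<le> M"
proof -
  obtain M where M: "0 < M" "\<And>i. \<bar>J i\<bar> \<le> M" using J_bounded by blast
  have S: "(\<lambda>n. C * M * (a powi n * norm (f n))) summable_on UNIV"
    by (intro summable_on_cmult_right assms)
  have bound: "norm ((C * a powi n * J (i + n)) *\<^sub>R f n) \<le> C * M * (a powi n * norm (f n))" for i n
  proof -
    have "(C * a powi n * norm (f n)) * \<bar>J (i + n)\<bar> \<le> (C * a powi n * norm (f n)) * M"
      using M C_pos a_powi_pos[of n] by (intro mult_left_mono) auto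
    then show ?thesis using C_pos a_powi_pos[of n] by (simp add: abs_mult mult_ac)
  qed
  have "(\<lambda>n. (C * a powi n * J (i + n)) *\<^sub>R f n) summable_on UNIV" for i
    using Infinite_Sum.abs_summable_on_comparison_test'[OF S bound] by (rule abs_summable_summable)
  then have has: "((\<lambda>n. (C * a powi n * J (i + n)) *\<^sub>R f n) has_sum bessel_fourier f i) UNIV" for i
    unfolding bessel_fourier_def by (rule has_sum_infsum)
  then show "((\<lambda>n. (C * a powi n * J (i + n)) *\<^sub>R f n) has_sum bessel_fourier f i) UNIV" .
  have "norm (bessel_fourier f i) \<le> (\<Sum>\<^sub>\<infinity>n. C * M * (a powi n * norm (f n)))" for i
    by (rule norm_infsum_le[OF has has_sum_infsum[OF S] bound])
  then show "\<exists>M. \<forall>i. norm (bessel_fourier f i) \<le> M" by blast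
qed

text \<open>
  Fubini is legitimate because \<open>J\<close> is bounded and weighted summable, and orthogonality collapses the
  inner sum.
\<close>

lemma bessel_fourier_inversion:
  fixes f :: "int \<Rightarrow> 'a::banach"
  assumes f: "(\<lambda>n. a powi n * norm (f n)) summable_on UNIV"
  shows "bessel_fourier (bessel_fourier f) i = f i"
proof -
  obtain M where M: "0 < M" "\<And>i. \<bar>J i\<bar> \<le> M" using J_bounded by blast
  define g where "g s t = (C * a powi t * J (i + t)) *\<^sub>R (C * a powi s * J (t + s)) *\<^sub>R f s" for s t
  define h where "h s t = (C\<^sup>2 * M * (a powi s * norm (f s))) * (a powi t * \<bar>J (t + i)\<bar>)" for s t
  define R where "R s = (if i = s then f s else 0)" for s
  have bound: "norm (g s t) \<le> h s t" for s t
  proof -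
    have "(C\<^sup>2 * a powi s * norm (f s) * a powi t * \<bar>J (t + i)\<bar>) * \<bar>J (t + s)\<bar>
       \<le> (C\<^sup>2 * a powi s * norm (f s) * a powi t * \<bar>J (t + i)\<bar>) * M"
      using M C_pos a_powi_pos[of s] a_powi_pos[of t] by (intro mult_left_mono) auto
    then show ?thesis
      using C_pos a_powi_pos[of s] a_powi_pos[of t]
      by (simp add: g_def h_def abs_mult power2_eq_square mult_ac add.commute)
  qed
  have h: "(h s has_sum (C\<^sup>2 * M * (a powi s * norm (f s))) * (\<Sum>\<^sub>\<infinity>t. a powi t * \<bar>J (t + i)\<bar>)) UNIV" for s
    unfolding h_def by (intro has_sum_cmult_right has_sum_infsum J_weighted_summable)
  have H: "(\<lambda>s. (C\<^sup>2 * M * (a powi s * norm (f s))) * (\<Sum>\<^sub>\<infinity>t. a powi t * \<bar>J (t + i)\<bar>)) summable_on UNIV"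
    by (intro summable_on_cmult_left summable_on_cmult_right f)
  have rows: "(g s has_sum R s) UNIV" for s
  proof -
    have lin: "bounded_linear (\<lambda>r. r *\<^sub>R a powi s *\<^sub>R f s)"
      by (rule bounded_linear_scaleR_left)
    have "((\<lambda>t. (C\<^sup>2 * a powi t * (J (i + t) * J (s + t))) *\<^sub>R a powi s *\<^sub>R f s)
        has_sum (if i = s then a powi (- i) else 0) *\<^sub>R a powi s *\<^sub>R f s) UNIV"
      using has_sum_bounded_linear[OF lin J_orthogonal[of i s]] by (simp add: o_def)
    moreover have "(if i = s then a powi (- i) else 0) *\<^sub>R a powi s *\<^sub>R f s = R s"
      using a_powi_add[of "- s" s] by (simp add: R_def)
    moreover have "g s = (\<lambda>t. (C\<^sup>2 * a powi t * (J (i + t) * J (s + t))) *\<^sub>R a powi s *\<^sub>R f s)"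
      by (rule ext) (simp add: g_def power2_eq_square mult_ac add.commute)
    ultimately show ?thesis by (simp only:)
  qed
  have cols: "((\<lambda>s. g s t) has_sum (C * a powi t * J (i + t)) *\<^sub>R bessel_fourier f t) UNIV" for t
    unfolding g_def by (intro has_sum_scaleR bessel_fourier_has_sum(1) f)
  have "(R has_sum f i) UNIV"
    by (rule has_sum_finite_neutralI[of "{i}"]) (auto simp: R_def)
  then have "((\<lambda>t. (C * a powi t * J (i + t)) *\<^sub>R bessel_fourier f t) has_sum f i) UNIV"
    using has_sum_exchange[OF bound h H rows cols] by simp
  then show ?thesis
    unfolding bessel_fourier_def[of "bessel_fourier f"] by (rule infsumI)
qed

text \<open>
  The quadratic form with coefficients \<open>z r\<close> equals the integral of \<open>\<xi>\<close> against the square of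
  \<open>g t = \<Sum>r. z r * J (r + t)\<close>. The choice \<open>z r = a^r J(r + s)\<close> makes \<open>g\<close> approach, by
  orthogonality, a multiple of the unit mass at \<open>s\<close>, so that the form tends to a positive multiple of \<open>\<xi> s\<close>.
  As \<open>\<xi>\<close> is only known to be bounded, \<open>g\<^sup>2\<close> has to converge in the weighted \<open>L\<^sup>1\<close> sense.
  This comes for free: by orthogonality the weighted \<open>L\<^sup>2\<close> norm of \<open>g\<close> is controlled by the single value
  \<open>g s\<close>, which therefore also controls the mass that \<open>g\<^sup>2\<close> leaves outside \<open>s\<close>.
\<close>

lemma nonneg_of_positive_definite:
  fixes \<xi> :: "int \<Rightarrow> complex"
  assumes \<xi>: "\<And>t. norm (\<xi> t) \<le> M"
    and T: "\<And>r l. ((\<lambda>t. (C * a powi t * (J (r + t) * J (l + t))) *\<^sub>R \<xi> t) has_sum T r l) UNIV"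
    and pos: "\<And>A z. finite A \<Longrightarrow> (\<Sum>r\<in>A. \<Sum>l\<in>A. z r * cnj (z l) * T r l) \<in> \<real>\<^sub>\<ge>\<^sub>0"
  shows "\<xi> s \<in> \<real>\<^sub>\<ge>\<^sub>0"
proof -
  define z where "z r = a powi r * J (r + s)" for r
  define g where "g A t = (\<Sum>r\<in>A. z r * J (r + t))" for A t
  define Q where "Q A = (\<Sum>r\<in>A. \<Sum>l\<in>A. of_real (z r) * cnj (of_real (z l)) * T r l)" for A
  define L where "L = a powi (- s) / C\<^sup>2"
  let ?F = "finite_subsets_at_top UNIV"
  have M: "0 \<le> M" using \<xi>[of 0] norm_ge_zero order_trans by blast
  have sq: "(\<Sum>r\<in>A. \<Sum>l\<in>A. z r * z l * (J (r + t) * J (l + t))) = (g A t)\<^sup>2" for A t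
    unfolding g_def power2_eq_square sum_product by (intro sum.cong refl) (simp add: mult_ac)
  have Q_sum: "((\<lambda>t. (C * a powi t * (g A t)\<^sup>2) *\<^sub>R \<xi> t) has_sum Q A) UNIV" for A
  proof -
    have "((\<lambda>t. \<Sum>r\<in>A. \<Sum>l\<in>A. (z r * z l) *\<^sub>R (C * a powi t * (J (r + t) * J (l + t))) *\<^sub>R \<xi> t)
        has_sum (\<Sum>r\<in>A. \<Sum>l\<in>A. (z r * z l) *\<^sub>R T r l)) UNIV"
      by (intro has_sum_finite_sum has_sum_scaleR T)
    moreover have "(\<Sum>r\<in>A. \<Sum>l\<in>A. (z r * z l) *\<^sub>R (C * a powi t * (J (r + t) * J (l + t))) *\<^sub>R \<xi> t)
        = (C * a powi t * (g A t)\<^sup>2) *\<^sub>R \<xi> t" for t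
      unfolding sq[symmetric] sum_distrib_left scaleR_sum_left
      by (intro sum.cong refl) (simp add: mult_ac)
    moreover have "(\<Sum>r\<in>A. \<Sum>l\<in>A. (z r * z l) *\<^sub>R T r l) = Q A"
      unfolding Q_def by (intro sum.cong refl) (simp add: scaleR_conv_of_real)
    ultimately show ?thesis by (simp only:)
  qed
  have norm_sum: "((\<lambda>t. C\<^sup>2 * a powi t * (g A t)\<^sup>2) has_sum g A s) UNIV" if "finite A" for A
  proof -
    have "((\<lambda>t. \<Sum>r\<in>A. \<Sum>l\<in>A. (z r * z l) * (C\<^sup>2 * a powi t * (J (r + t) * J (l + t))))
        has_sum (\<Sum>r\<in>A. \<Sum>l\<in>A. (z r * z l) * (if r = l then a powi (- r) else 0))) UNIV"
      by (intro has_sum_finite_sum has_sum_cmult_right J_orthogonal)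
    moreover have "(\<Sum>r\<in>A. \<Sum>l\<in>A. (z r * z l) * (C\<^sup>2 * a powi t * (J (r + t) * J (l + t))))
        = C\<^sup>2 * a powi t * (g A t)\<^sup>2" for t
      unfolding sq[symmetric] sum_distrib_left by (intro sum.cong refl) (simp add: mult_ac)
    moreover have "(\<Sum>l\<in>A. (z r * z l) * (if r = l then a powi (- r) else 0)) = z r * J (r + s)"
      if "r \<in> A" for r
    proof -
      have "(\<Sum>l\<in>A. (z r * z l) * (if r = l then a powi (- r) else 0))
          = (\<Sum>l\<in>A. if r = l then z r * z r * a powi (- r) else 0)"
        by (intro sum.cong) auto
      also have "\<dots> = z r * (a powi r * a powi (- r)) * J (r + s)"
        using \<open>finite A\<close> that by (simp add: z_def[of r] mult_ac)
      also have "a powi r * a powi (- r) = 1" using a_powi_add[of r "- r"] by simp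
      finally show ?thesis by simp
    qed
    ultimately show ?thesis by (simp add: g_def cong: sum.cong)
  qed
  \<comment> \<open>The limit is the diagonal case of orthogonality, summed over \<open>r\<close> instead of \<open>n\<close>.\<close>
  have g_lim: "((\<lambda>A. g A s) \<longlongrightarrow> L) ?F"
  proof -
    have "((\<lambda>n. C\<^sup>2 * a powi n * (J (s + n) * J (s + n))) has_sum a powi (- s)) UNIV"
      using J_orthogonal[of s s] by simp
    then have "((\<lambda>n. (1 / C\<^sup>2) * (C\<^sup>2 * a powi n * (J (s + n) * J (s + n)))) has_sum (1 / C\<^sup>2) * a powi (- s)) UNIV"
      by (rule has_sum_cmult_right)
    moreover have "(1 / C\<^sup>2) * (C\<^sup>2 * a powi n * (J (s + n) * J (s + n))) = z n * J (n + s)" for n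
      using C_pos by (simp add: z_def add.commute)
    ultimately have "((\<lambda>n. z n * J (n + s)) has_sum L) UNIV"
      by (simp add: L_def)
    then show ?thesis unfolding has_sum_def g_def .
  qed
  \<comment> \<open>All mass of \<open>g\<^sup>2\<close> away from \<open>s\<close> is bounded by the total mass minus the mass at \<open>s\<close>.\<close>
  have error: "norm (Q A - (C * a powi s * (g A s)\<^sup>2) *\<^sub>R \<xi> s)
      \<le> (M / C) * (g A s - C\<^sup>2 * a powi s * (g A s)\<^sup>2)" if "finite A" for A
  proof -
    have 1: "((\<lambda>t. (C * a powi t * (g A t)\<^sup>2) *\<^sub>R \<xi> t)
        has_sum (Q A - (C * a powi s * (g A s)\<^sup>2) *\<^sub>R \<xi> s)) (UNIV - {s})"
      by (intro has_sum_Diff Q_sum has_sum_finiteI) simp_all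
    have 2: "((\<lambda>t. (M / C) * (C\<^sup>2 * a powi t * (g A t)\<^sup>2))
        has_sum (M / C) * (g A s - C\<^sup>2 * a powi s * (g A s)\<^sup>2)) (UNIV - {s})"
      by (intro has_sum_cmult_right has_sum_Diff norm_sum that has_sum_finiteI) simp_all
    have "norm ((C * a powi t * (g A t)\<^sup>2) *\<^sub>R \<xi> t) \<le> (M / C) * (C\<^sup>2 * a powi t * (g A t)\<^sup>2)" for t
    proof -
      have "(C * a powi t * (g A t)\<^sup>2) * norm (\<xi> t) \<le> (C * a powi t * (g A t)\<^sup>2) * M"
        using C_pos a_powi_pos[of t] \<xi> by (intro mult_left_mono) auto
      then show ?thesis
        using C_pos a_powi_pos[of t] by (simp add: abs_mult power2_eq_square mult_ac)
    qed
    then show ?thesis by (rule norm_infsum_le[OF 1 2])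
  qed
  have CL: "C\<^sup>2 * a powi s * L = 1"
    using C_pos a_powi_add[of s "- s"] by (simp add: L_def)
  have "((\<lambda>A. (M / C) * (g A s - C\<^sup>2 * a powi s * (g A s)\<^sup>2)) \<longlongrightarrow> (M / C) * (L - C\<^sup>2 * a powi s * L\<^sup>2)) ?F"
    by (intro tendsto_intros g_lim)
  moreover have "L - C\<^sup>2 * a powi s * L\<^sup>2 = 0"
    using CL by (simp add: power2_eq_square mult.assoc[symmetric])
  ultimately have bound_lim: "((\<lambda>A. (M / C) * (g A s - C\<^sup>2 * a powi s * (g A s)\<^sup>2)) \<longlongrightarrow> 0) ?F"
    by simp
  have diff_lim: "((\<lambda>A. Q A - (C * a powi s * (g A s)\<^sup>2) *\<^sub>R \<xi> s) \<longlongrightarrow> 0) ?F"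
    by (rule Lim_null_comparison[OF _ bound_lim]) (intro eventually_finite_subsets_at_top_weakI error)
  have "((\<lambda>A. (Q A - (C * a powi s * (g A s)\<^sup>2) *\<^sub>R \<xi> s) + (C * a powi s * (g A s)\<^sup>2) *\<^sub>R \<xi> s)
      \<longlongrightarrow> 0 + (C * a powi s * L\<^sup>2) *\<^sub>R \<xi> s) ?F"
    by (intro tendsto_intros g_lim diff_lim)
  then have Q_lim: "(Q \<longlongrightarrow> (C * a powi s * L\<^sup>2) *\<^sub>R \<xi> s) ?F" by simp
  have "Q A \<in> \<real>\<^sub>\<ge>\<^sub>0" if "finite A" for A
    unfolding Q_def by (rule pos[OF that])
  then have "(C * a powi s * L\<^sup>2) *\<^sub>R \<xi> s \<in> \<real>\<^sub>\<ge>\<^sub>0"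
    by (intro Lim_in_closed_set[OF closed_nonneg_Reals_complex _ _ Q_lim]
        eventually_finite_subsets_at_top_weakI) simp_all
  moreover have "0 < C * a powi s * L\<^sup>2"
    unfolding L_def by (intro mult_pos_pos zero_less_power divide_pos_pos C_pos a_powi_pos)
  ultimately show ?thesis
    by (auto simp: complex_nonneg_Reals_iff zero_le_mult_iff)
qed

text \<open>
  The kernel \<open>J\<close> oscillates, so summability of the transform cannot be read off by letting the argument
  tend to 0 in the inversion formula. Integrate instead against the dilates \<open>K (n + k)\<close>. By Fubini and
  self-duality the integral is \<open>\<Sum>s. a^(s - k) K(s - k) \<phi> s\<close>, which is bounded by \<open>B\<close> times the
  weighted sum of \<open>K\<close>, uniformly in \<open>k\<close> since dilation does not change the latter. On a given
  finite set of exponents \<open>K (n + k) \<ge> 1\<close> for large \<open>k\<close>, and nonnegativity of the transform bounds its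
  partial sums.
\<close>

lemma bessel_fourier_nonneg_summable:
  fixes \<phi> :: "int \<Rightarrow> complex"
  assumes sum: "(\<lambda>n. a powi n * norm (\<phi> n)) summable_on UNIV"
    and B: "\<And>n. norm (\<phi> n) \<le> B"
    and nonneg: "\<And>n. bessel_fourier \<phi> n \<in> \<real>\<^sub>\<ge>\<^sub>0"
  shows "(\<lambda>n. a powi n * norm (bessel_fourier \<phi> n)) summable_on UNIV"
proof -
  obtain M where M: "0 < M" "\<And>i. \<bar>J i\<bar> \<le> M" using J_bounded by blast
  let ?\<xi> = "bessel_fourier \<phi>"
  have weighted: "\<exists>S. ((\<lambda>n. (a powi n * K (n + k)) *\<^sub>R ?\<xi> n) has_sum S) UNIV \<and> norm S \<le> B * qexp a" for k
  proof -
    define f where "f s n = (a powi n * K (n + k)) *\<^sub>R (C * a powi s * J (n + s)) *\<^sub>R \<phi> s" for s n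
    define h where "h s n = (C * M * a powi (- k) * (a powi s * norm (\<phi> s))) * (a powi (n + k) * K (n + k))" for s n
    define R where "R s = (a powi (s - k) * K (s - k)) *\<^sub>R \<phi> s" for s
    have shift: "a powi n = a powi (- k) * a powi (n + k)" for n
      using a_powi_add[of "- k" "n + k"] by simp
    have bound: "norm (f s n) \<le> h s n" for s n
    proof -
      have "(a powi n * K (n + k) * C * a powi s * norm (\<phi> s)) * \<bar>J (n + s)\<bar>
          \<le> (a powi n * K (n + k) * C * a powi s * norm (\<phi> s)) * M"
        using M C_pos a_powi_pos[of n] a_powi_pos[of s] K_nonneg[of "n + k"]
        by (intro mult_left_mono) auto
      moreover have "h s n = (a powi n * K (n + k) * C * a powi s * norm (\<phi> s)) * M"
        unfolding h_def by (subst shift[of n]) (simp only: mult_ac)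
      moreover have "norm (f s n) = (a powi n * K (n + k) * C * a powi s * norm (\<phi> s)) * \<bar>J (n + s)\<bar>"
        using C_pos a_powi_pos[of n] a_powi_pos[of s] K_nonneg[of "n + k"]
        by (simp add: f_def abs_mult)
      ultimately show ?thesis by (simp only:)
    qed
    have h: "(h s has_sum (C * M * a powi (- k) * (a powi s * norm (\<phi> s))) * qexp a) UNIV" for s
      unfolding h_def by (intro has_sum_cmult_right K_weighted_shift)
    have H: "(\<lambda>s. (C * M * a powi (- k) * (a powi s * norm (\<phi> s))) * qexp a) summable_on UNIV"
      by (intro summable_on_cmult_left summable_on_cmult_right sum)
    have rows: "(f s has_sum R s) UNIV" for s
    proof -
      have lin: "bounded_linear (\<lambda>r. r *\<^sub>R a powi s *\<^sub>R \<phi> s)"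
        by (rule bounded_linear_scaleR_left)
      have "((\<lambda>n. (C * a powi n * J (s + n) * K (n + k)) *\<^sub>R a powi s *\<^sub>R \<phi> s)
          has_sum (a powi (- k) * K (s - k)) *\<^sub>R a powi s *\<^sub>R \<phi> s) UNIV"
        using has_sum_bounded_linear[OF lin bessel_fourier_K_shift[of s k]] by (simp add: o_def)
      moreover have "f s = (\<lambda>n. (C * a powi n * J (s + n) * K (n + k)) *\<^sub>R a powi s *\<^sub>R \<phi> s)"
        by (rule ext) (simp add: f_def mult_ac add.commute)
      moreover have "(a powi (- k) * K (s - k)) *\<^sub>R a powi s *\<^sub>R \<phi> s = R s"
        using a_powi_add[of s "- k"] by (simp add: R_def mult_ac)
      ultimately show ?thesis by (simp only:)
    qed
    have cols: "((\<lambda>s. f s n) has_sum (a powi n * K (n + k)) *\<^sub>R ?\<xi> n) UNIV" for n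
      unfolding f_def by (intro has_sum_scaleR bessel_fourier_has_sum(1) sum)
    \<comment> \<open>Bounding \<open>\<phi>\<close> by \<open>B\<close>, and not by its weighted sum, removes the dependence on \<open>k\<close>.\<close>
    have majorant: "((\<lambda>s. B * (a powi (s - k) * K (s - k))) has_sum B * qexp a) UNIV"
      using has_sum_cmult_right[OF K_weighted_shift[of "- k"]] by simp
    have R_le: "norm (R s) \<le> B * (a powi (s - k) * K (s - k))" for s
    proof -
      have "(a powi (s - k) * K (s - k)) * norm (\<phi> s) \<le> (a powi (s - k) * K (s - k)) * B"
        using a_powi_pos[of "s - k"] K_nonneg[of "s - k"] B by (intro mult_left_mono) auto
      then show ?thesis
        using a_powi_pos[of "s - k"] K_nonneg[of "s - k"] by (simp add: R_def abs_mult mult_ac)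
    qed
    have "(\<lambda>s. norm (R s)) summable_on UNIV"
      by (rule Infinite_Sum.abs_summable_on_comparison_test'[OF has_sum_imp_summable[OF majorant]])
         (rule R_le)
    then have "(R has_sum infsum R UNIV) UNIV"
      by (rule has_sum_infsum[OF abs_summable_summable])
    moreover from norm_infsum_le[OF this majorant R_le] have "norm (infsum R UNIV) \<le> B * qexp a" .
    ultimately show ?thesis using has_sum_exchange[OF bound h H rows cols] by blast
  qed
  have norm_eq: "norm (?\<xi> n) = Re (?\<xi> n)" for n
    using nonneg[of n] by (simp add: complex_nonneg_Reals_iff cmod_eq_Re)
  show ?thesis
  proof (rule nonneg_bounded_partial_sums_imp_summable_on)
    show "0 \<le> a powi n * norm (?\<xi> n)" for n using a_powi_pos[of n] by simp
    have "(\<Sum>n\<in>F. a powi n * norm (?\<xi> n)) \<le> B * qexp a" if fin: "finite F" for F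
    proof -
      obtain k where k: "\<And>n. n \<in> F \<Longrightarrow> 0 \<le> n + k"
      proof -
        have "bdd_below F" using fin by simp
        then obtain l where "\<And>n. n \<in> F \<Longrightarrow> l \<le> n" unfolding bdd_below_def by blast
        then show ?thesis using that[of "- l"] by simp
      qed
      obtain S where S: "((\<lambda>n. (a powi n * K (n + k)) *\<^sub>R ?\<xi> n) has_sum S) UNIV" "norm S \<le> B * qexp a"
        using weighted by blast
      have "(\<Sum>n\<in>F. a powi n * norm (?\<xi> n)) \<le> (\<Sum>n\<in>F. Re ((a powi n * K (n + k)) *\<^sub>R ?\<xi> n))"
      proof (rule sum_mono)
        fix n assume "n \<in> F"
        have "(a powi n * norm (?\<xi> n)) * 1 \<le> (a powi n * norm (?\<xi> n)) * K (n + k)"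
          using K_ge_1[OF k[OF \<open>n \<in> F\<close>]] a_powi_pos[of n] by (intro mult_left_mono) auto
        then show "a powi n * norm (?\<xi> n) \<le> Re ((a powi n * K (n + k)) *\<^sub>R ?\<xi> n)"
          by (simp add: norm_eq mult_ac)
      qed
      also have "\<dots> \<le> Re S"
      proof (rule finite_sum_le_has_sum[OF has_sum_Re[OF S(1)]])
        show "0 \<le> Re ((a powi n * K (n + k)) *\<^sub>R ?\<xi> n)" for n
          using norm_ge_zero[of "?\<xi> n"] a_powi_pos[of n] K_nonneg[of "n + k"] by (simp add: norm_eq)
      qed (use fin in auto)
      also have "\<dots> \<le> B * qexp a" using complex_Re_le_cmod[of S] S(2) by linarith
      finally show ?thesis .
    qed
    then show "\<forall>\<^sub>F F in finite_subsets_at_top UNIV. (\<Sum>n\<in>F. a powi n * norm (?\<xi> n)) \<le> B * qexp a"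
      by (intro eventually_finite_subsets_at_top_weakI)
  qed
qed

end

section \<open>Functions on the lattice of powers of q\<close>

lemma weight_lattice:
  fixes q v :: real and n :: int
  assumes "0 < q"
  shows "q powi n * (q powi n) powr (2 * v + 1) = (q powr (2 * v + 2)) powi n"
proof -
  have pow: "q powi n = q powr real_of_int n" and pow': "(q powr (2 * v + 2)) powi n = (q powr (2 * v + 2)) powr real_of_int n"
    using assms powr_real_of_int'[of q n] powr_real_of_int'[of "q powr (2 * v + 2)" n] by simp_all
  show ?thesis
    unfolding pow pow' powr_powr powr_add[symmetric] by (simp add: algebra_simps)
qed

lemma lattice_interpretation:
  assumes "0 < q" "q < 1" "v > -1"
  shows "q_bessel_lattice q (q powr (2 * v + 2))"
proof
  show "q powr (2 * v + 2) < 1"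
    using assms powr_less_mono'[of q 0 "2 * v + 2"] by simp
qed (use assms in auto)

context
  fixes q v :: real
  assumes q: "0 < q" "q < 1" and v: "v > -1"
begin

interpretation q_bessel_lattice q "q powr (2 * v + 2)"
  by (rule lattice_interpretation) (rule q v)+

lemma L1q_iff: "f \<in> L1q q v \<longleftrightarrow> (\<lambda>n::int. (q powr (2 * v + 2)) powi n * norm (f (q powi n))) summable_on UNIV"
proof -
  have "q powi n *\<^sub>R (cmod (f (q powi n)) * (q powi n) powr (2 * v + 1))
      = (q powr (2 * v + 2)) powi n * norm (f (q powi n))" for n :: int
    unfolding weight_lattice[OF q(1), symmetric] by (simp add: mult_ac)
  then show ?thesis by (simp only: L1q_def jackson_integrable_def mem_Collect_eq)
qed

lemma qbessel_lattice: "qbessel q v (q powi i * q powi n) = J (i + n)"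
proof -
  have "q powi i * q powi n = q powi (i + n)" using q by (simp add: power_int_add)
  then show ?thesis by (simp add: qbessel_def J_def p_def)
qed

lemma cqv_eq: "cqv q v * (1 - q) = C"
  using q by (simp add: cqv_def C_def p_def)

lemma qfourier_lattice: "qfourier q v f (q powi i) = bessel_fourier (\<lambda>n. f (q powi n)) i"
proof -
  have eq: "q powi n *\<^sub>R (f (q powi n) * of_real (qbessel q v (q powi i * q powi n)) * of_real ((q powi n) powr (2 * v + 1)))
      = ((q powr (2 * v + 2)) powi n * J (i + n)) *\<^sub>R f (q powi n)" for n
    unfolding qbessel_lattice weight_lattice[OF q(1), symmetric]
    by (simp add: scaleR_conv_of_real mult_ac)
  show ?thesis
    unfolding qfourier_def jackson_integral_def eq bessel_fourier_def cqv_eq[symmetric]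
    by (simp add: infsum_scaleR_right[symmetric] scaleR_conv_of_real[symmetric] mult.assoc)
qed

lemma qtrans_lattice:
  "qtrans q v (q powi r) f (q powi l) =
     (\<Sum>\<^sub>\<infinity>t. (C * (q powr (2 * v + 2)) powi t * (J (r + t) * J (l + t))) *\<^sub>R bessel_fourier (\<lambda>n. f (q powi n)) t)"
proof -
  have eq: "q powi n *\<^sub>R (qfourier q v f (q powi n) * of_real (qbessel q v (q powi r * q powi n)) *
        of_real (qbessel q v (q powi l * q powi n)) * of_real ((q powi n) powr (2 * v + 1)))
      = ((q powr (2 * v + 2)) powi n * (J (r + n) * J (l + n))) *\<^sub>R bessel_fourier (\<lambda>n. f (q powi n)) n" for n
    unfolding qbessel_lattice qfourier_lattice weight_lattice[OF q(1), symmetric]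
    by (simp add: scaleR_conv_of_real mult_ac)
  show ?thesis
    unfolding qtrans_def jackson_integral_def eq cqv_eq[symmetric]
    by (simp add: infsum_scaleR_right[symmetric] scaleR_conv_of_real[symmetric] mult.assoc)
qed

text \<open>
  The witness for the representation is the transform of \<open>\<phi>\<close> itself. A finite set of exponents is
  enumerated to match the indexed families in the definition of positive type.
\<close>

lemma positive_type_is_fourier_of_nonneg:
  assumes \<phi>: "q_positive_type q v \<phi>"
  shows "qfourier q v \<phi> \<in> qwiener q v"
    and "x \<in> Rq q \<Longrightarrow> qfourier q v \<phi> x \<in> \<real>\<^sub>\<ge>\<^sub>0"
    and "x \<in> Rq q \<Longrightarrow> \<phi> x = qfourier q v (qfourier q v \<phi>) x"
proof -
  define f where "f n = \<phi> (q powi n)" for n :: int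
  let ?\<xi> = "bessel_fourier f"
  have \<xi>: "qfourier q v \<phi> (q powi n) = ?\<xi> n" for n
    unfolding qfourier_lattice f_def ..
  have L1: "\<phi> \<in> L1q q v" and "bounded (\<phi> ` Rq q)"
    using \<phi> by (simp_all add: q_positive_type_def Cqb_def)
  then obtain B where B: "norm (f n) \<le> B" for n
    unfolding bounded_iff f_def Rq_def by blast
  have sum: "(\<lambda>n. (q powr (2 * v + 2)) powi n * norm (f n)) summable_on UNIV"
    using L1 unfolding L1q_iff f_def .
  obtain M where M: "norm (?\<xi> n) \<le> M" for n
    using bessel_fourier_has_sum(2)[OF sum] by blast
  define T where "T r l = qtrans q v (q powi r) \<phi> (q powi l)" for r l
  have T: "((\<lambda>t. (C * (q powr (2 * v + 2)) powi t * (J (r + t) * J (l + t))) *\<^sub>R ?\<xi> t) has_sum T r l) UNIV" for r l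
  proof -
    obtain M' where M': "0 < M'" "\<And>i. \<bar>J i\<bar> \<le> M'" using J_bounded by blast
    have S: "(\<lambda>t. (C * M' * M) * ((q powr (2 * v + 2)) powi t * \<bar>J (t + r)\<bar>)) summable_on UNIV"
      by (intro summable_on_cmult_right J_weighted_summable)
    have "norm ((C * (q powr (2 * v + 2)) powi t * (J (r + t) * J (l + t))) *\<^sub>R ?\<xi> t)
        \<le> (C * M' * M) * ((q powr (2 * v + 2)) powi t * \<bar>J (t + r)\<bar>)" for t
    proof -
      have "(C * (q powr (2 * v + 2)) powi t * \<bar>J (t + r)\<bar>) * (\<bar>J (l + t)\<bar> * norm (?\<xi> t))
          \<le> (C * (q powr (2 * v + 2)) powi t * \<bar>J (t + r)\<bar>) * (M' * M)"
        using C_pos a_powi_pos[of t] M' M less_imp_le[OF M'(1)] by (intro mult_left_mono mult_mono) auto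
      then show ?thesis
        using C_pos a_powi_pos[of t] by (simp add: abs_mult mult_ac add.commute)
    qed
    then have "(\<lambda>t. (C * (q powr (2 * v + 2)) powi t * (J (r + t) * J (l + t))) *\<^sub>R ?\<xi> t) summable_on UNIV"
      by (rule abs_summable_summable[OF Infinite_Sum.abs_summable_on_comparison_test'[OF S]])
    then show ?thesis
      unfolding T_def qtrans_lattice f_def[abs_def] by (rule has_sum_infsum)
  qed
  have pos: "(\<Sum>r\<in>A. \<Sum>l\<in>A. z r * cnj (z l) * T r l) \<in> \<real>\<^sub>\<ge>\<^sub>0" if fin: "finite A" for A z
  proof -
    obtain h where h: "bij_betw h {1..card A} A"
      using ex_bij_betw_nat_finite_1[OF fin] by blast
    have "\<forall>r\<in>{1..card A}. q powi h r \<in> Rq q" by (auto simp: Rq_def)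
    then have mem: "(\<Sum>r=1..card A. \<Sum>l=1..card A. z (h r) * cnj (z (h l)) * T (h r) (h l)) \<in> \<real>\<^sub>\<ge>\<^sub>0"
      using \<phi> unfolding q_positive_type_def T_def
      by (elim conjE allE[of _ "card A"] allE[of _ "\<lambda>r. z (h r)"] allE[of _ "\<lambda>r. q powi h r"]) blast
    have "(\<Sum>r=1..card A. \<Sum>l=1..card A. z (h r) * cnj (z (h l)) * T (h r) (h l))
        = (\<Sum>r=1..card A. \<Sum>l\<in>A. z (h r) * cnj (z l) * T (h r) l)"
      by (intro sum.cong refl sum.reindex_bij_betw[OF h])
    also have "\<dots> = (\<Sum>r\<in>A. \<Sum>l\<in>A. z r * cnj (z l) * T r l)"
      by (rule sum.reindex_bij_betw[OF h])
    finally show ?thesis using mem by (simp only:)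
  qed
  have nonneg: "?\<xi> n \<in> \<real>\<^sub>\<ge>\<^sub>0" for n
    by (rule nonneg_of_positive_definite[OF M T pos])
  then show "x \<in> Rq q \<Longrightarrow> qfourier q v \<phi> x \<in> \<real>\<^sub>\<ge>\<^sub>0"
    by (auto simp: Rq_def \<xi>)
  have inv: "qfourier q v (qfourier q v \<phi>) (q powi n) = \<phi> (q powi n)" for n
    unfolding qfourier_lattice[of "qfourier q v \<phi>"] \<xi>
    by (simp add: bessel_fourier_inversion[OF sum] f_def)
  then show "x \<in> Rq q \<Longrightarrow> \<phi> x = qfourier q v (qfourier q v \<phi>) x"
    by (auto simp: Rq_def)
  show "qfourier q v \<phi> \<in> qwiener q v"
    unfolding qwiener_def L1q_iff mem_Collect_eq \<xi> inv
    using bessel_fourier_nonneg_summable[OF sum B nonneg] L1 by (simp add: L1q_iff)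
qed

end

theorem corollary2:
  fixes v q :: real and \<phi> :: "real \<Rightarrow> complex"
  assumes "v > -1" and "q \<in> Qv v" and "q_positive_type q v \<phi>"
  shows "\<exists>\<xi> \<in> qwiener q v. (\<forall>x \<in> Rq q. \<xi> x \<in> \<real>\<^sub>\<ge>\<^sub>0) \<and> (\<forall>x \<in> Rq q. \<phi> x = qfourier q v \<xi> x)"
proof -
  have q: "0 < q" "q < 1" using assms(2) by (auto simp: Qv_def)
  show ?thesis
    using positive_type_is_fourier_of_nonneg[OF q assms(1,3)] by blast
qed

end
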